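(* For $n\ge0$, let $c_{0,0}(2n)$ be the number of walks of length $2n$ with steps $(\pm1,\pm1)$ (all four sign choices), starting and ending at $(0,0)$, all of whose vertices lie in $\mathcal C=\{(i,j)\in\mathbb Z^2:i\ge0\text{ or }j\ge0\}$. Then $$c_{0,0}(2n)=\frac{16^n}9\left(3\,\frac{(1/2)_n^2}{(2)_n^2}+8\,\frac{(1/2)_n(7/6)_n}{(2)_n(4/3)_n}-2\,\frac{(1/2)_n(5/6)_n}{(2)_n(5/3)_n}\right),$$ and, as $n\to\infty$, $$c_{0,0}(2n)\sim\frac{2^5}{3^2}\,\frac{\Gamma(2/3)}{\pi}\,\frac{4^{2n}}{(2n)^{5/3}}.$$
   Context: $(a)_n=a(a+1)\cdots(a+n-1)$ denotes the ascending factorial, with $(a)_0=1$. *)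

theory Defs
  imports "HOL-Analysis.Analysis" "HOL-Library.Landau_Symbols"
begin

definition diagonal_steps :: "(int \<times> int) set" where
  "diagonal_steps = {(1, 1), (1, -1), (-1, 1), (-1, -1)}"

definition three_quadrant_cone :: "(int \<times> int) set" where
  "three_quadrant_cone = {(i, j). i \<ge> 0 \<or> j \<ge> 0}"

(* A walk of length m is the list of its m + 1 vertices; since distinct steps have
   distinct displacement vectors, this determines the sequence of steps. *)
definition walks :: "(int \<times> int) set \<Rightarrow> (int \<times> int) set \<Rightarrow> int \<times> int \<Rightarrow> int \<times> int \<Rightarrow> nat
    \<Rightarrow> (int \<times> int) list set" where
  "walks S C p q m = {vs. length vs = Suc m \<and> hd vs = p \<and> last vs = q \<and> set vs \<subseteq> C \<and>
     (\<forall>k<m. vs ! Suc k - vs ! k \<in> S)}"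

definition c :: "int \<Rightarrow> int \<Rightarrow> nat \<Rightarrow> nat" where
  "c i j m = card (walks diagonal_steps three_quadrant_cone (0, 0) (i, j) m)"

end

theory Submission
  imports Defs
begin

text \<open>
  Shift the lattice by \<open>(1,1)\<close>: the walk starts at \<open>(1,1)\<close>, and it is killed on the quadrant
  \<open>i \<le> 0\<close>, \<open>j \<le> 0\<close>. Write \<open>G\<^sub>n(i,j)\<close> for the number of walks of length \<open>n\<close> that end at \<open>(i,j)\<close>.
  All the information needed is carried by the walks that end on the positive half-axis,
  \<open>H(x) = (\<Sum> n i. G\<^sub>n(i,0) x^i t^n)\<close>, for two reasons.
  Reflection in both axes shows that \<open>G\<^sub>n(i,j) - G\<^sub>n(i,-j) - G\<^sub>n(-i,j)\<close> counts the walks confined to the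
  open quadrant, so \<open>G\<^sub>2\<^sub>n(1,1) - 2 G\<^sub>2\<^sub>n(1,-1)\<close> is the square of a Catalan number
  (\<open>reflection\<close>). And the last step before the axis makes \<open>G\<^sub>2\<^sub>n(1,1) + G\<^sub>2\<^sub>n(1,-1)\<close> a coefficient of
  \<open>H\<close> at \<open>x\<^sup>2 = -1\<close> (\<open>axis_series_at_minus_1\<close>). It remains to find \<open>H\<close>, which is algebraic.

  The functional equation. Fold the half-plane \<open>i > 0\<close> along the axis \<open>j = 0\<close>. The generating function of the
  folded walks satisfies a linear equation with a kernel that vanishes at the power series \<open>Y(x)\<close> with
  \<open>Y = t (x + 1/x) (1 + Y\<^sup>2)\<close>. This series does not change under \<open>x \<mapsto> 1/x\<close>, so subtracting the two
  equations removes the unknown first column. With \<open>u = x\<^sup>2\<close>, \<open>s = t\<^sup>2\<close>, \<open>v = Y\<^sup>2\<close>,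
  \<open>\<eta>(u) = t H(x)\<close> and \<open>M(u) = (1 + 2u + 3(1 + u)\<eta>(u)) / (1 - u)\<close>, what remains is
  \<open>M(u) + M(1/u) + M(v) = 0\<close> (\<open>functional_equation\<close>).

  The cubic. The function \<open>j(u) = (1 - u)\<^sup>2 (4s(1 + u)\<^sup>2 - u) / (u (1 + u)\<^sup>2)\<close> takes the same value at \<open>u\<close>,
  \<open>1/u\<close> and \<open>v\<close>. This suggests that the three values of \<open>M\<close> are the roots of one cubic
  \<open>j (4M\<^sup>3 - 3M - 1) + 16 (\<beta> M + \<delta>) = 0\<close> with \<open>\<beta>\<close>, \<open>\<delta>\<close> depending on \<open>s\<close> only. Choose \<open>\<beta>\<close> and
  \<open>\<delta>\<close> such that the left-hand side times \<open>1 - u\<close>, called \<open>\<Theta>(u)\<close>, vanishes at \<open>u = 1\<close> and \<open>u = 0\<close>. Since the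
  \<open>M\<close>-values sum to zero, the \<open>\<Theta>\<close>-values satisfy one linear relation; its lowest
  coefficient in \<open>s\<close> says that a polynomial \<open>p\<close> with \<open>p(0) = p(1) = 0\<close> satisfies
  \<open>p(u) = u\<^sup>2 p(1/u)\<close>, and this forces \<open>p = 0\<close>. Hence \<open>\<Theta> = 0\<close> (\<open>\<Theta>_eq_0\<close>).

  The parameters. Where \<open>u = v\<close>, that is at \<open>y = t (1 + y)\<^sup>2\<close>, the function \<open>j\<close> is critical but \<open>M\<close> is not, so
  the cubic has a double root there and its discriminant vanishes. Since \<open>\<beta>\<close> and \<open>\<delta>\<close> are even in \<open>t\<close>, the
  same holds with \<open>-t\<close>, which gives two equations for \<open>\<beta>\<close> and \<open>\<delta>\<close> (\<open>algebraic_system\<close>). They are solved by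
  a rational parametrization: the series \<open>\<zeta>\<close> that encodes \<open>H\<close> at \<open>u = -1\<close> satisfies
  \<open>\<zeta>\<^sup>2 (1 + \<epsilon>)(3 - \<epsilon>)\<^sup>3 = 16\<close> where \<open>256 s = \<zeta>\<^sup>2 (1 - \<epsilon>)(3 + \<epsilon>)\<^sup>3\<close>
  (\<open>parametrization\<close>). In these terms \<open>(3 + \<epsilon>\<^sup>2) \<zeta>\<close> and \<open>(3 - \<epsilon>\<^sup>2) \<zeta>\<close> are,
  up to constants, the hypergeometric series \<open>F(-1/2, 1/6; 1/3; 16s)\<close> and
  \<open>F(-1/2, -1/6; 2/3; 16s)\<close>, and \<open>6\<zeta>\<close> is their sum. This gives the closed form
  (\<open>c_closed_form\<close>). The asymptotics follow from the growth of Pochhammer symbols: the middle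
  summand dominates, and the duplication formula of the Gamma function simplifies its constant.
\<close>

unbundle no vec_syntax
unbundle fps_syntax

section \<open>Evaluating power series with polynomial coefficients\<close>

definition fps_peval :: "'a::comm_ring_1 poly \<Rightarrow> 'a fps \<Rightarrow> 'a fps" where
  "fps_peval p y = poly (map_poly fps_const p) y"

lemma fps_peval_0 [simp]: "fps_peval 0 y = 0"
  by (simp add: fps_peval_def)

lemma fps_peval_pCons [simp]: "fps_peval (pCons a p) y = fps_const a + y * fps_peval p y"
  by (simp add: fps_peval_def map_poly_pCons)

lemma fps_peval_1 [simp]: "fps_peval 1 y = 1"
  by (simp add: one_pCons)

lemma fps_peval_add [simp]: "fps_peval (p + q) y = fps_peval p y + fps_peval q y"
  by (induction p q rule: poly_induct2) (simp_all add: algebra_simps flip: fps_const_add)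

lemma fps_peval_smult [simp]: "fps_peval (smult a p) y = fps_const a * fps_peval p y"
  by (induction p) (simp_all add: algebra_simps flip: fps_const_mult)

lemma fps_peval_mult [simp]: "fps_peval (p * q) y = fps_peval p y * fps_peval q y"
  by (induction p) (simp_all add: algebra_simps)

lemma fps_peval_sum: "fps_peval (sum f A) y = (\<Sum>x\<in>A. fps_peval (f x) y)"
  by (induction A rule: infinite_finite_induct) simp_all

lemma fps_peval_const: "fps_peval p (fps_const a) = fps_const (poly p a)"
  by (induction p) simp_all

lemma fps_peval_nth_0: "fps_peval p y $ 0 = poly p (y $ 0)"
  by (induction p) simp_all

lemma fps_peval_monom: "fps_peval (monom a n) y = fps_const a * y ^ n"
  by (induction n) (simp_all add: monom_0 monom_Suc algebra_simps)

text \<open>The substitution \<open>s \<mapsto> \<tau>\<close>, \<open>u \<mapsto> y\<close> in a power series in \<open>s\<close> whose coefficients are polynomials in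
  \<open>u\<close>. Polynomial coefficients allow \<open>y\<close> to have a nonzero constant term, which is needed for
  \<open>u\<close> and \<open>1/u\<close> at the same time; only \<open>\<tau>\<close> has to vanish at zero.\<close>
definition fps_ev :: "'a::comm_ring_1 fps \<Rightarrow> 'a fps \<Rightarrow> 'a poly fps \<Rightarrow> 'a fps" where
  "fps_ev \<tau> y F = Abs_fps (\<lambda>n. (\<Sum>k\<le>n. \<tau> ^ k * fps_peval (F $ k) y) $ n)"

lemma fps_power_mult_nth_eq_0:
  fixes \<tau> :: "'a::comm_ring_1 fps"
  assumes "\<tau> $ 0 = 0" "n < k"
  shows "(\<tau> ^ k * g) $ n = 0"
  using assms by (auto simp: fps_mult_nth startsby_zero_power_prefix intro!: sum.neutral)

lemma fps_ev_nth:
  fixes \<tau> :: "'a::comm_ring_1 fps"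
  assumes "\<tau> $ 0 = 0" "n \<le> N"
  shows "fps_ev \<tau> y F $ n = (\<Sum>k\<le>N. \<tau> ^ k * fps_peval (F $ k) y) $ n"
proof -
  have "(\<Sum>k\<le>N. (\<tau> ^ k * fps_peval (F $ k) y) $ n) = (\<Sum>k\<le>n. (\<tau> ^ k * fps_peval (F $ k) y) $ n)"
    using assms by (intro sum.mono_neutral_right) (auto simp: fps_power_mult_nth_eq_0)
  then show ?thesis by (simp add: fps_ev_def fps_sum_nth)
qed

lemma fps_ev_add [simp]: "fps_ev \<tau> y (F + G) = fps_ev \<tau> y F + fps_ev \<tau> y G"
  by (rule fps_ext) (simp add: fps_ev_def fps_sum_nth algebra_simps sum.distrib)

text \<open>Coefficient \<open>n\<close> depends on the terms of index at most \<open>n\<close> only, so both sides reduce to finite sums; in the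
  product of these sums the pairs with \<open>i + l > n\<close> do not contribute.\<close>
lemma fps_ev_mult:
  fixes \<tau> :: "'a::comm_ring_1 fps"
  assumes \<tau>: "\<tau> $ 0 = 0"
  shows "fps_ev \<tau> y (F * G) = fps_ev \<tau> y F * fps_ev \<tau> y G"
proof (rule fps_ext)
  fix n
  let ?p = "\<lambda>k. \<tau> ^ k * fps_peval (F $ k) y" and ?q = "\<lambda>k. \<tau> ^ k * fps_peval (G $ k) y"
  have "(fps_ev \<tau> y F * fps_ev \<tau> y G) $ n = ((\<Sum>k\<le>n. ?p k) * (\<Sum>k\<le>n. ?q k)) $ n"
    unfolding fps_mult_nth using fps_ev_nth[OF \<tau>, of _ n] by (intro sum.cong) auto
  also have "\<dots> = (\<Sum>(i,l)\<in>{..n}\<times>{..n}. (?p i * ?q l) $ n)"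
    by (simp add: sum_product sum.cartesian_product fps_sum_nth case_prod_unfold)
  also have "\<dots> = (\<Sum>(i,l)\<in>{(i,l). i + l \<le> n}. (?p i * ?q l) $ n)"
  proof (rule sum.mono_neutral_right)
    have *: "(?p i * ?q l) $ n = 0" if "\<not> i + l \<le> n" for i l
    proof -
      have "?p i * ?q l = \<tau> ^ (i + l) * (fps_peval (F $ i) y * fps_peval (G $ l) y)"
        by (simp add: power_add algebra_simps)
      then show ?thesis using fps_power_mult_nth_eq_0[OF \<tau>] that by simp
    qed
    show "\<forall>z\<in>{..n} \<times> {..n} - {(i, l). i + l \<le> n}. (\<lambda>(i, l). (?p i * ?q l) $ n) z = 0"
      using * by fast
  qed auto
  also have "\<dots> = (\<Sum>k\<le>n. \<Sum>i\<le>k. (?p i * ?q (k - i)) $ n)"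
    by (rule sum.triangle_reindex_eq)
  also have "\<dots> = (\<Sum>k\<le>n. \<tau> ^ k * fps_peval ((F * G) $ k) y) $ n"
    unfolding fps_sum_nth
  proof (rule sum.cong[OF refl])
    fix k
    have "\<tau> ^ k * (fps_peval (F $ i) y * fps_peval (G $ (k - i)) y) = ?p i * ?q (k - i)"
      if "i \<le> k" for i
    proof -
      have "?p i * ?q (k - i) = (\<tau> ^ i * \<tau> ^ (k - i)) * (fps_peval (F $ i) y * fps_peval (G $ (k - i)) y)"
        by (simp only: ac_simps)
      then show ?thesis using that by (simp flip: power_add)
    qed
    then have "\<tau> ^ k * fps_peval ((F * G) $ k) y = (\<Sum>i\<le>k. ?p i * ?q (k - i))"
      unfolding fps_mult_nth fps_peval_sum sum_distrib_left atLeast0AtMost fps_peval_mult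
      by (intro sum.cong) auto
    then show "(\<Sum>i\<le>k. (?p i * ?q (k - i)) $ n) = (\<tau> ^ k * fps_peval ((F * G) $ k) y) $ n"
      by (simp add: fps_sum_nth)
  qed
  finally show "fps_ev \<tau> y (F * G) $ n = (fps_ev \<tau> y F * fps_ev \<tau> y G) $ n"
    by (simp add: fps_ev_def)
qed

lemma fps_ev_const: "fps_ev \<tau> y (fps_const p) = fps_peval p y"
proof (rule fps_ext)
  fix n
  have "(\<Sum>k\<le>n. \<tau> ^ k * fps_peval (fps_const p $ k) y) = (\<Sum>k\<le>n. if k = 0 then fps_peval p y else 0)"
    by (intro sum.cong) auto
  then show "fps_ev \<tau> y (fps_const p) $ n = fps_peval p y $ n" by (simp add: fps_ev_def)
qed

lemma fps_ev_numeral [simp]: "fps_ev \<tau> y (numeral n) = numeral n"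
proof -
  have "(numeral n :: 'a poly) = [:numeral n:]" by (simp add: numeral_poly)
  then have "(numeral n :: 'a poly fps) = fps_const [:numeral n:]" by (metis numeral_fps_const)
  then have "fps_ev \<tau> y (numeral n) = fps_peval [:numeral n:] y" by (simp only: fps_ev_const)
  then show ?thesis by (simp add: numeral_fps_const)
qed

lemma fps_ev_0 [simp]: "fps_ev \<tau> y 0 = 0"
  using fps_ev_const[of \<tau> y 0] by simp

lemma fps_ev_1 [simp]: "fps_ev \<tau> y 1 = 1"
  using fps_ev_const[of \<tau> y 1] by simp

lemma fps_ev_uminus [simp]: "fps_ev \<tau> y (- F) = - fps_ev \<tau> y F"
  using fps_ev_add[of \<tau> y F "-F"] by (simp add: eq_neg_iff_add_eq_0 add.commute del: fps_ev_add)

lemma fps_ev_diff [simp]: "fps_ev \<tau> y (F - G) = fps_ev \<tau> y F - fps_ev \<tau> y G"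
  using fps_ev_add[of \<tau> y F "-G"] by (simp del: fps_ev_add)

lemma fps_ev_power:
  fixes \<tau> :: "'a::comm_ring_1 fps"
  assumes "\<tau> $ 0 = 0"
  shows "fps_ev \<tau> y (F ^ k) = fps_ev \<tau> y F ^ k"
  by (induction k) (simp_all add: fps_ev_mult assms)

lemma fps_ev_X:
  fixes \<tau> :: "'a::comm_ring_1 fps"
  assumes "\<tau> $ 0 = 0"
  shows "fps_ev \<tau> y fps_X = \<tau>"
proof (rule fps_ext)
  fix n
  have "(\<Sum>k\<le>Suc n. \<tau> ^ k * fps_peval (fps_X $ k) y) = (\<Sum>k\<le>Suc n. if k = 1 then \<tau> else 0)"
    by (intro sum.cong) auto
  then show "fps_ev \<tau> y fps_X $ n = \<tau> $ n" by (simp add: fps_ev_nth[OF assms, of n "Suc n"])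
qed

text \<open>Power series in \<open>s\<close> alone, as series with constant polynomials as coefficients.\<close>
definition fps_lift :: "'a::comm_ring_1 fps \<Rightarrow> 'a poly fps" where
  "fps_lift f = Abs_fps (\<lambda>n. [:f $ n:])"

lemma fps_ev_lift:
  fixes \<tau> :: "'a::comm_ring_1 fps"
  assumes "\<tau> $ 0 = 0"
  shows "fps_ev \<tau> y (fps_lift f) = f oo \<tau>"
proof (rule fps_ext)
  fix n
  show "fps_ev \<tau> y (fps_lift f) $ n = (f oo \<tau>) $ n"
    by (simp add: fps_ev_nth[OF assms order_refl] fps_lift_def fps_compose_nth fps_sum_nth
      mult.commute[of "\<tau> ^ _"] atLeast0AtMost)
qed

text \<open>The derivative with respect to \<open>u\<close>, with \<open>s\<close> held constant.\<close>
definition fps_pderiv :: "'a::idom poly fps \<Rightarrow> 'a poly fps" where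
  "fps_pderiv F = Abs_fps (\<lambda>n. pderiv (F $ n))"

lemma fps_pderiv_add: "fps_pderiv (F + G) = fps_pderiv F + fps_pderiv G"
  by (rule fps_ext) (simp add: fps_pderiv_def pderiv_add)

lemma fps_pderiv_diff: "fps_pderiv (F - G) = fps_pderiv F - fps_pderiv G"
  by (rule fps_ext) (simp add: fps_pderiv_def pderiv_diff)

lemma pderiv_sum_finite: "pderiv (sum f A) = (\<Sum>x\<in>A. pderiv (f x))"
  by (induction A rule: infinite_finite_induct) (simp_all add: pderiv_add)

lemma fps_pderiv_mult: "fps_pderiv (F * G) = fps_pderiv F * G + F * fps_pderiv G"
  by (rule fps_ext)
    (simp add: fps_pderiv_def fps_mult_nth pderiv_sum_finite pderiv_mult sum.distrib add.commute
      mult.commute[of "G $ _"])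

lemma fps_pderiv_lift: "fps_pderiv (fps_lift f) = 0"
  by (rule fps_ext) (simp add: fps_pderiv_def fps_lift_def pderiv_pCons)

lemma fps_pderiv_X: "fps_pderiv fps_X = 0"
  by (rule fps_ext) (simp add: fps_pderiv_def fps_X_def)

lemma fps_pderiv_const: "fps_pderiv (fps_const p) = fps_const (pderiv p)"
  by (rule fps_ext) (simp add: fps_pderiv_def)

section \<open>Counting walks by their last step; reflection\<close>

text \<open>Walks in the coordinates shifted by \<open>(1,1)\<close>, so that the killing set is the closed quadrant
  \<open>i \<le> 0 \<and> j \<le> 0\<close> and reflections in its sides are sign changes.\<close>
fun diag_walks :: "nat \<Rightarrow> int \<Rightarrow> int \<Rightarrow> real" where
  "diag_walks 0 i j = (if i = 1 \<and> j = 1 then 1 else 0)"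
| "diag_walks (Suc n) i j = (if i > 0 \<or> j > 0
     then diag_walks n (i + 1) (j + 1) + diag_walks n (i + 1) (j - 1)
        + diag_walks n (i - 1) (j + 1) + diag_walks n (i - 1) (j - 1) else 0)"

text \<open>Removing the last vertex; the recursion for \<open>diag_walks\<close> is the cardinality version.\<close>
lemma walks_Suc:
  "walks S C p q (Suc m) = (if q \<in> C then (\<Union>d\<in>S. (\<lambda>vs. vs @ [q]) ` walks S C p (q - d) m) else {})"
    (is "?L = ?R")
proof (intro equalityI subsetI)
  fix vs assume vs: "vs \<in> ?L"
  then obtain us where us: "vs = us @ [q]" "length us = Suc m"
    by (cases vs rule: rev_cases) (auto simp: walks_def)
  have q: "q \<in> C" using vs us by (simp add: walks_def)
  have "vs ! Suc m - vs ! m \<in> S" using vs by (simp add: walks_def)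
  then have d: "q - last us \<in> S" using us
    by (cases us rule: rev_cases) (auto simp: nth_append)
  have st: "us ! Suc k - us ! k \<in> S" if "k < m" for k
  proof -
    have "vs ! Suc k - vs ! k \<in> S" using vs that by (simp add: walks_def)
    then show ?thesis using us that by (simp add: nth_append)
  qed
  have "hd us = p" using vs us by (cases us) (auto simp: walks_def)
  then have "us \<in> walks S C p (q - (q - last us)) m"
    using vs us st unfolding walks_def by auto
  then show "vs \<in> ?R" using us d q by (simp, blast)
next
  fix vs assume "vs \<in> ?R"
  then obtain d us where *: "q \<in> C" "d \<in> S" "us \<in> walks S C p (q - d) m" "vs = us @ [q]"
    by (auto split: if_splits)
  then have l: "length us = Suc m" "last us = q - d" "hd us = p" "set us \<subseteq> C" 
    and st: "\<And>k. k < m \<Longrightarrow> us ! Suc k - us ! k \<in> S"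
    by (auto simp: walks_def)
  have lu: "us ! m = q - d" using l by (metis diff_Suc_1 last_conv_nth list.size(3) nat.distinct(1))
  have "vs ! Suc k - vs ! k \<in> S" if "k < Suc m" for k
    using that l lu st * by (cases "k = m") (auto simp: nth_append)
  then show "vs \<in> ?L" using * l unfolding walks_def by (auto simp: hd_append)
qed

lemma finite_walks:
  assumes "finite S"
  shows "finite (walks S C p q m)"
proof (induction m arbitrary: q)
  case 0
  have "walks S C p q 0 \<subseteq> {[p]}" by (auto simp: walks_def length_Suc_conv)
  then show ?case by (rule finite_subset) simp
next
  case (Suc m)
  then show ?case using assms by (simp add: walks_Suc)
qed

lemma card_walks_Suc:
  assumes "finite S" "q \<in> C"
  shows "card (walks S C p q (Suc m)) = (\<Sum>d\<in>S. card (walks S C p (q - d) m))"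
proof -
  have "card (walks S C p q (Suc m)) = card (\<Union>d\<in>S. (\<lambda>vs. vs @ [q]) ` walks S C p (q - d) m)"
    using assms by (simp add: walks_Suc)
  also have "\<dots> = (\<Sum>d\<in>S. card ((\<lambda>vs. vs @ [q]) ` walks S C p (q - d) m))"
    using assms by (intro card_UN_disjoint) (auto simp: finite_walks, auto simp: walks_def)
  also have "\<dots> = (\<Sum>d\<in>S. card (walks S C p (q - d) m))"
    by (intro sum.cong refl card_image) (auto simp: inj_on_def)
  finally show ?thesis .
qed

lemma diag_walks_eq_c: "diag_walks n i j = real (c (i - 1) (j - 1) n)"
proof (induction n arbitrary: i j)
  case 0
  have "walks diagonal_steps three_quadrant_cone (0,0) (i - 1, j - 1) 0 = (if i = 1 \<and> j = 1 then {[(0,0)]} else {})"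
    by (auto simp: walks_def length_Suc_conv three_quadrant_cone_def)
  then show ?case by (auto simp: c_def)
next
  case (Suc n)
  show ?case
  proof (cases "i > 0 \<or> j > 0")
    case True
    then have "(i - 1, j - 1) \<in> three_quadrant_cone" by (auto simp: three_quadrant_cone_def)
    then have "c (i - 1) (j - 1) (Suc n) = (\<Sum>d\<in>diagonal_steps.
        card (walks diagonal_steps three_quadrant_cone (0,0) ((i - 1, j - 1) - d) n))"
      unfolding c_def by (intro card_walks_Suc) (auto simp: diagonal_steps_def)
    also have "\<dots> = c (i + 1 - 1) (j + 1 - 1) n + c (i + 1 - 1) (j - 1 - 1) n 
        + c (i - 1 - 1) (j + 1 - 1) n + c (i - 1 - 1) (j - 1 - 1) n"
      by (simp add: diagonal_steps_def c_def)
    finally show ?thesis using True by (simp add: Suc.IH)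
  next
    case False
    then have "(i - 1, j - 1) \<notin> three_quadrant_cone" by (auto simp: three_quadrant_cone_def)
    then show ?thesis using False by (simp add: c_def walks_Suc)
  qed
qed

lemma diag_walks_sym: "diag_walks n i j = diag_walks n j i"
  by (induction n arbitrary: i j) (auto simp: algebra_simps)

lemma diag_walks_outside: "i \<le> 0 \<Longrightarrow> j \<le> 0 \<Longrightarrow> diag_walks n i j = 0"
  by (cases n) auto

text \<open>Each step changes both coordinates by an odd number.\<close>
lemma diag_walks_parity1: "even (i + int n) \<Longrightarrow> diag_walks n i j = 0"
  by (induction n arbitrary: i j) auto

lemma diag_walks_parity2: "even (j + int n) \<Longrightarrow> diag_walks n i j = 0"
  by (subst diag_walks_sym) (rule diag_walks_parity1)

lemma diag_walks_support: "i > int n + 1 \<Longrightarrow> diag_walks n i j = 0"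
  by (induction n arbitrary: i j) auto

lemma diag_walks_support': "j > int n + 1 \<Longrightarrow> diag_walks n i j = 0"
  by (subst diag_walks_sym) (rule diag_walks_support)

text \<open>Walks on the positive integers from \<open>1\<close> to \<open>i\<close>. A diagonal step moves the two coordinates independently,
  so the walks in the open quadrant are counted by products of these numbers.\<close>
fun ballot :: "nat \<Rightarrow> int \<Rightarrow> real" where
  "ballot 0 i = (if i = 1 then 1 else 0)"
| "ballot (Suc n) i = (if i > 0 then ballot n (i - 1) + ballot n (i + 1) else 0)"

lemma ballot_0: "i \<le> 0 \<Longrightarrow> ballot n i = 0"
  by (cases n) auto

text \<open>The left-hand side obeys the recursion of the walks confined to the open quadrant: for \<open>i,j > 0\<close> all three
  points lie in the cone, and on each axis two of the terms cancel and the third point is killed.\<close>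
lemma reflection:
  assumes "i \<ge> 0" "j \<ge> 0"
  shows "diag_walks n i j - diag_walks n i (-j) - diag_walks n (-i) j = ballot n i * ballot n j"
  using assms
proof (induction n arbitrary: i j)
  case (Suc n)
  show ?case
  proof (cases "i = 0 \<or> j = 0")
    case True
    then show ?thesis using Suc.prems
      by (auto simp: ballot_0 diag_walks_outside simp del: ballot.simps diag_walks.simps)
  next
    case False
    then have ij: "i > 0" "j > 0" using Suc.prems by auto
    have IH: "diag_walks n a b - diag_walks n a (-b) - diag_walks n (-a) b = ballot n a * ballot n b"
      if "a \<in> {i - 1, i + 1}" "b \<in> {j - 1, j + 1}" for a b
      using Suc.IH[of a b] that ij by auto
    note I = IH[of "i-1" "j-1"] IH[of "i-1" "j+1"] IH[of "i+1" "j-1"] IH[of "i+1" "j+1"]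
    have e: "- (x - 1) = - x + 1" "- (x + 1) = - x - 1" for x :: int by auto
    show ?thesis using I ij unfolding e by (simp add: algebra_simps)
  qed
qed auto

text \<open>The difference of two binomial coefficients from the reflection principle on the line.\<close>
lemma ballot_closed:
  assumes "2 * k \<le> n + 1"
  shows "ballot n (int n + 1 - 2 * int k) =
    real (n choose k) - (if k = 0 then 0 else real (n choose (k - 1)))"
  using assms
proof (induction n arbitrary: k)
  case 0
  then have "k = 0" by simp
  then show ?case by simp
next
  case (Suc n)
  show ?case
  proof (cases "2 * k = n + 2")
    case True
    then obtain k' where k': "k = Suc k'" "n = 2 * k'" by (cases k) auto
    have "Suc n choose k = Suc n choose k'" using binomial_symmetric[of "Suc k'" "Suc (2 * k')"] k'
      by (simp del: binomial_Suc_Suc)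
    then show ?thesis using k' by (simp add: ballot_0)
  next
    case False
    then have k: "2 * k \<le> n + 1" using Suc.prems by auto
    have A: "ballot n (int n + 1 - 2 * int k) = 
      real (n choose k) - (if k = 0 then 0 else real (n choose (k - 1)))" using Suc.IH k by blast
    show ?thesis
    proof (cases k)
      case 0
      have "ballot n (int n + 3) = 0"
      proof -
        have "ballot m i = 0" if "i > int m + 1" for m i using that
          by (induction m arbitrary: i) auto
        then show ?thesis by simp
      qed
      then show ?thesis using A 0 by (simp add: algebra_simps)
    next
      case (Suc k')
      have B: "ballot n (int n + 1 - 2 * int k') = 
        real (n choose k') - (if k' = 0 then 0 else real (n choose (k' - 1)))"
        using Suc.IH[of k'] k Suc by auto
      have e1: "int (Suc n) + 1 - 2 * int k - 1 = int n + 1 - 2 * int k"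
        and e2: "int (Suc n) + 1 - 2 * int k + 1 = int n + 1 - 2 * int k'" using Suc by auto
      have "ballot (Suc n) (int (Suc n) + 1 - 2 * int k) = 
         ballot n (int n + 1 - 2 * int k) + ballot n (int n + 1 - 2 * int k')"
        unfolding ballot.simps e1 e2 using k by auto
      then show ?thesis unfolding A B using Suc by (cases k') (auto simp: algebra_simps)
    qed
  qed
qed

lemma ballot_catalan: "ballot (2 * n) 1 = 4 ^ n * pochhammer (1/2) n / pochhammer 2 n"
proof -
  have "ballot (2 * n) 1 = real (2*n choose n) - (if n = 0 then 0 else real (2*n choose (n - 1)))"
    using ballot_closed[of n "2*n"] by simp
  also have "\<dots> = real (2*n choose n) / (n + 1)"
  proof (cases n)
    case (Suc m)
    have "Suc m * (2*n choose Suc m) = (2*n - m) * (2*n choose m)"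
      by (simp only: binomial_absorption binomial_absorb_comp)
    then have "real (Suc m * (2*n choose Suc m)) = real ((m + 2) * (2*n choose m))" using Suc by simp
    then show ?thesis using Suc by (simp add: field_simps)
  qed auto
  also have "\<dots> = 4 ^ n * pochhammer (1/2) n / pochhammer 2 n"
  proof -
    have "pochhammer 2 n = (fact (Suc n) :: real)"
      by (simp add: pochhammer_fact pochhammer_rec)
    moreover have "real (2*n choose n) = fact (2*n) / (fact n * fact n)"
      using binomial_fact[of n "2*n"] by simp
    moreover have "fact (2*n) = 4 ^ n * pochhammer (1/2) n * (fact n :: real)"
      by (simp add: fact_double power_mult)
    ultimately show ?thesis by (simp add: divide_simps)
  qed
  finally show ?thesis .
qed

section \<open>The walks that end on the positive axis\<close>

declare diag_walks.simps [simp del] ballot.simps [simp del]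

text \<open>The half-plane \<open>i > 0\<close> folded along the axis \<open>j = 0\<close>. There all points with \<open>i > 0\<close> belong to the cone, so
  the folded numbers obey the free recursion; folding keeps only nonnegative exponents of \<open>y\<close> in the generating
  function, so that a series can be substituted for \<open>y\<close>.\<close>
definition folded :: "nat \<Rightarrow> int \<Rightarrow> int \<Rightarrow> real" where
  "folded n i j = diag_walks n i j + diag_walks n i (- j)"

lemma folded_Suc:
  assumes "i > 0"
  shows "folded (Suc n) i j = folded n (i + 1) (j - 1) + folded n (i + 1) (j + 1)
    + (folded n (i - 1) (j - 1) + folded n (i - 1) (j + 1))"
proof -
  have e: "- j + 1 = - (j - 1)" "- j - 1 = - (j + 1)" by auto
  show ?thesis using assms unfolding folded_def diag_walks.simps e by simp
qed

lemma folded_support: "i > int n + 1 \<Longrightarrow> folded n i j = 0"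
  by (simp add: folded_def diag_walks_support)

lemma diag_walks_support'': "i \<ge> 0 \<Longrightarrow> j < - int n - 1 \<Longrightarrow> diag_walks n i j = 0"
proof (induction n arbitrary: i j)
  case 0 then show ?case by (simp add: diag_walks.simps)
next
  case (Suc n)
  show ?case
  proof (cases "i > 0")
    case True
    have "diag_walks n a b = 0" if "a \<in> {i - 1, i + 1}" "b \<in> {j - 1, j + 1}" for a b
      using Suc.IH[of a b] that True Suc.prems by auto
    then show ?thesis by (simp add: diag_walks.simps)
  next
    case False
    then show ?thesis using Suc.prems by (simp add: diag_walks_outside)
  qed
qed

lemma folded_support':
  assumes "i \<ge> 0" "j > int n + 1"
  shows "folded n i j = 0"
  using assms by (simp add: folded_def diag_walks_support' diag_walks_support'')

lemma diag_walks_axis_Suc: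
  assumes "i > 0"
  shows "diag_walks (Suc n) i 0 = folded n (i + 1) 1 + folded n (i - 1) 1"
  using assms by (simp add: folded_def diag_walks.simps)

text \<open>By parity, walks that end on the axis \<open>j = 0\<close> have odd length \<open>2k+1\<close> and even abscissa
  \<open>2m+2\<close>. This series collects them with weight \<open>s^k u^m\<close>; with \<open>s = t\<^sup>2\<close> and \<open>u = x\<^sup>2\<close> the generating
  function \<open>H(x)\<close> is \<open>t u\<close> times it.\<close>
definition axis_series :: "real poly fps" where
  "axis_series = Abs_fps (\<lambda>k. \<Sum>m\<le>k. monom (diag_walks (2 * k + 1) (2 * int m + 2) 0) m)"

text \<open>By the last step before the axis, the alternating sum telescopes.\<close>
lemma axis_series_at_minus_1: "poly (axis_series $ k) (- 1) = folded (2 * k) 1 1"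
proof -
  define s where "s m = folded (2 * k) (2 * int m + 1) 1" for m
  have "(\<Sum>m\<le>K. (- 1) ^ m * (s (Suc m) + s m)) = s 0 + (- 1) ^ K * s (Suc K)" for K
    by (induction K) (simp_all add: algebra_simps)
  moreover have "diag_walks (2 * k + 1) (2 * int m + 2) 0 = s (Suc m) + s m" for m
    using diag_walks_axis_Suc[of "2 * int m + 2" "2 * k"] by (simp add: s_def algebra_simps)
  moreover have "s (Suc k) = 0" by (simp add: s_def folded_support)
  moreover have "s 0 = folded (2 * k) 1 1" by (simp add: s_def)
  ultimately show ?thesis
    by (simp add: axis_series_def poly_sum poly_monom mult.commute)
qed

text \<open>With \<open>a = G(1,1)\<close> and \<open>b = G(1,-1)\<close>, the values \<open>a - 2b\<close> and \<open>a + b\<close> are known, and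
  \<open>3a = 2(a + b) + (a - 2b)\<close>.\<close>
lemma c_eq_axis_series:
  "real (c 0 0 (2 * n)) = 2/3 * poly (axis_series $ n) (- 1) + (ballot (2 * n) 1)\<^sup>2 / 3"
proof -
  have "diag_walks (2 * n) 1 1 - 2 * diag_walks (2 * n) 1 (- 1) = (ballot (2 * n) 1)\<^sup>2"
    using reflection[of 1 1 "2 * n"] diag_walks_sym[of "2 * n" "-1" 1] by (simp add: power2_eq_square)
  moreover have "real (c 0 0 (2 * n)) = diag_walks (2 * n) 1 1"
    using diag_walks_eq_c[of "2 * n" 1 1] by simp
  ultimately show ?thesis
    unfolding axis_series_at_minus_1 folded_def by (simp add: field_simps)
qed

text \<open>The boundary terms \<open>g 0\<close> and \<open>g 1\<close> are the walks that enter and leave the half-plane through its edge.\<close>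
lemma shift_sum:
  fixes w :: real and g :: "int \<Rightarrow> real"
  assumes "w \<noteq> 0"
  shows "(\<Sum>i=1..N. w ^ i * (g (int i + 1) + g (int i - 1))) =
    (w + 1 / w) * (\<Sum>i=1..N. w ^ i * g (int i)) - g 1 + w * g 0
      + w ^ N * g (int N + 1) - w ^ (N + 1) * g (int N)"
proof (induction N)
  case (Suc N)
  have "int (Suc N) - 1 = int N" "int (Suc N) = int N + 1" by auto
  then show ?case using Suc assms by (simp add: field_simps)
qed simp

definition poly_upto :: "(nat \<Rightarrow> real) \<Rightarrow> nat \<Rightarrow> real poly" where
  "poly_upto f N = (\<Sum>j=1..N. monom (f j) j)"

lemma coeff_poly_upto: "coeff (poly_upto f N) j = (if 1 \<le> j \<and> j \<le> N then f j else 0)"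
  by (simp add: poly_upto_def coeff_sum)

definition axis_poly :: "nat \<Rightarrow> real poly" where
  "axis_poly n = poly_upto (\<lambda>i. diag_walks n (int i) 0) (n + 1)"

lemma pair_sum: 
  fixes f :: "nat \<Rightarrow> 'a::comm_monoid_add"
  shows "(\<Sum>i=1..2 * k + 2. f i) = (\<Sum>m\<le>k. f (2 * m + 1) + f (2 * m + 2))" 
proof (induction k)
  case 0
  have "{1..2::nat} = {1, 2}" by auto
  then show ?case by simp
next
  case (Suc k)
  have "{1..2 * Suc k + 2} = insert (2 * Suc k + 2) (insert (2 * Suc k + 1) {1..2 * k + 2})" by auto
  then show ?case using Suc by (simp add: ac_simps)
qed

lemma axis_poly_odd:
  "fps_peval (axis_poly (2 * k + 1)) y = y\<^sup>2 * fps_peval (axis_series $ k) (y\<^sup>2)"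
proof -
  let ?h = "\<lambda>i. fps_const (diag_walks (2 * k + 1) (int i) 0) * y ^ i"
  have "fps_peval (axis_poly (2 * k + 1)) y = (\<Sum>i=1..2 * k + 2. ?h i)"
    by (simp add: axis_poly_def poly_upto_def fps_peval_sum fps_peval_monom)
  also have "\<dots> = (\<Sum>m\<le>k. ?h (2 * m + 1) + ?h (2 * m + 2))" by (rule pair_sum)
  also have "\<dots> = (\<Sum>m\<le>k. y\<^sup>2 * (fps_const (diag_walks (2 * k + 1) (2 * int m + 2) 0) * (y\<^sup>2) ^ m))"
  proof (intro sum.cong refl)
    fix m
    have "diag_walks (2 * k + 1) (int (2 * m + 1)) 0 = 0" by (rule diag_walks_parity1) simp
    moreover have "int (2 * m + 2) = 2 * int m + 2" by simp
    moreover have "y ^ (2 * m + 2) = y\<^sup>2 * (y\<^sup>2) ^ m"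
      by (metis power_add power_mult add.commute)
    ultimately show "?h (2 * m + 1) + ?h (2 * m + 2) = 
      y\<^sup>2 * (fps_const (diag_walks (2 * k + 1) (2 * int m + 2) 0) * (y\<^sup>2) ^ m)"
      by (simp only: fps_const_0_eq_0 mult_zero_left add_0_left mult.left_commute)
  qed
  also have "\<dots> = y\<^sup>2 * fps_peval (axis_series $ k) (y\<^sup>2)"
    by (simp add: axis_series_def fps_peval_sum fps_peval_monom sum_distrib_left)
  finally show ?thesis .
qed

lemma axis_poly_even: "axis_poly (2 * k) = 0"
  by (rule poly_eqI) (simp add: axis_poly_def coeff_poly_upto diag_walks_parity2)

lemma fps_mult_nth_cong:
  assumes "\<And>i. i \<le> n \<Longrightarrow> f $ i = g $ i"
  shows "(h * f) $ n = (h * g) $ n"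
  unfolding fps_mult_nth using assms by (intro sum.cong) auto

text \<open>The translation from the variables \<open>t\<close>, \<open>x\<close> to \<open>s = t\<^sup>2\<close>, \<open>u = x\<^sup>2\<close>.\<close>
lemma axis_parity_split:
  "fps_ev fps_X y (Abs_fps axis_poly) = fps_X * y\<^sup>2 * fps_ev (fps_X\<^sup>2) (y\<^sup>2) axis_series"
proof (rule fps_ext)
  fix n
  let ?p = "\<lambda>k. fps_X ^ k * fps_peval (axis_poly k) y"
  have p: "?p (2 * k) + ?p (2 * k + 1) =
      fps_X * y\<^sup>2 * ((fps_X\<^sup>2) ^ k * fps_peval (axis_series $ k) (y\<^sup>2))" for k
    unfolding axis_poly_odd by (simp add: axis_poly_even power_mult mult.assoc mult.left_commute)
  have "(\<Sum>k\<le>2 * n + 1. ?p k) = (\<Sum>k\<le>n. ?p (2 * k) + ?p (2 * k + 1))"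
    using sum.in_pairs_0[of ?p n] by (simp only: Suc_eq_plus1)
  also have "\<dots> = fps_X * y\<^sup>2 * (\<Sum>k\<le>n. (fps_X\<^sup>2) ^ k * fps_peval (axis_series $ k) (y\<^sup>2))"
    unfolding p sum_distrib_left ..
  finally have "fps_ev fps_X y (Abs_fps axis_poly) $ n =
     (fps_X * y\<^sup>2 * (\<Sum>k\<le>n. (fps_X\<^sup>2) ^ k * fps_peval (axis_series $ k) (y\<^sup>2))) $ n"
    by (subst fps_ev_nth[where N = "2 * n + 1"]) (simp_all only: fps_X_nth fps_nth_Abs_fps, simp_all)
  also have "\<dots> = (fps_X * y\<^sup>2 * fps_ev (fps_X\<^sup>2) (y\<^sup>2) axis_series) $ n"
    by (rule fps_mult_nth_cong) (simp add: fps_ev_nth[where N = n])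
  finally show "fps_ev fps_X y (Abs_fps axis_poly) $ n = (fps_X * y\<^sup>2 * fps_ev (fps_X\<^sup>2) (y\<^sup>2) axis_series) $ n" .
qed

section \<open>The kernel equation of the folded half-plane\<close>

text \<open>The coefficient of \<open>y^j t^n\<close> in the generating function of the folded walks, at a fixed number \<open>w\<close> in place of the first
  variable.\<close>
definition column_sum :: "real \<Rightarrow> nat \<Rightarrow> nat \<Rightarrow> real" where
  "column_sum w n j = (\<Sum>i=1..n + 1. w ^ i * folded n (int i) (int j))"

lemma column_sum_extend:
  assumes "N \<ge> n + 1"
  shows "(\<Sum>i=1..N. w ^ i * folded n (int i) (int j)) = column_sum w n j"
  unfolding column_sum_def
  using assms by (intro sum.mono_neutral_right) (auto simp: folded_support)

lemma column_sum_shift: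
  assumes "w \<noteq> 0" "N \<ge> n + 2"
  shows "(\<Sum>i=1..N. w ^ i * (folded n (int i + 1) (int j) + folded n (int i - 1) (int j))) =
    (w + 1 / w) * column_sum w n j - folded n 1 (int j) + w * folded n 0 (int j)"
  using assms shift_sum[OF assms(1), of "\<lambda>i. folded n i (int j)" N] column_sum_extend[of n N w j]
  by (simp add: folded_support)

lemma column_sum_Suc:
  assumes "w \<noteq> 0"
  shows "column_sum w (Suc n) (Suc j) = (w + 1 / w) * (column_sum w n j + column_sum w n (j + 2))
    - (folded n 1 (int j) + folded n 1 (int (j + 2)))
    + w * (folded n 0 (int j) + folded n 0 (int (j + 2)))"
proof -
  have e: "int (Suc j) - 1 = int j" "int (Suc j) + 1 = int (j + 2)" by auto
  have "n + 2 \<ge> n + 2" by simp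
  note shift = column_sum_shift[OF assms this]
  have *: "column_sum w (Suc n) (Suc j) =
      (\<Sum>i=1..n + 2. w ^ i * (folded n (int i + 1) (int j) + folded n (int i - 1) (int j)))
    + (\<Sum>i=1..n + 2. w ^ i * (folded n (int i + 1) (int (j + 2)) + folded n (int i - 1) (int (j + 2))))"
    unfolding column_sum_def sum.distrib[symmetric]
  proof (intro sum.cong)
    fix i assume "i \<in> {1..n + 2}"
    then have "int i > 0" by simp
    then show "w ^ i * folded (Suc n) (int i) (int (Suc j)) =
      w ^ i * (folded n (int i + 1) (int j) + folded n (int i - 1) (int j))
      + w ^ i * (folded n (int i + 1) (int (j + 2)) + folded n (int i - 1) (int (j + 2)))"
      unfolding folded_Suc[OF \<open>int i > 0\<close>] e by (simp add: algebra_simps)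
  qed simp
  show ?thesis unfolding * shift by (simp add: algebra_simps)
qed

lemma axis_poly_at: "poly (axis_poly n) w = (\<Sum>i=1..n + 1. w ^ i * diag_walks n (int i) 0)"
  by (simp add: axis_poly_def poly_upto_def poly_sum poly_monom mult.commute)

lemma column_sum_0: "column_sum w n 0 = 2 * poly (axis_poly n) w"
  by (simp add: column_sum_def axis_poly_at folded_def sum_distrib_left algebra_simps)

lemma axis_poly_at_Suc:
  assumes "w \<noteq> 0"
  shows "poly (axis_poly (Suc n)) w =
    (w + 1 / w) * column_sum w n 1 - folded n 1 1 + w * folded n 0 1"
proof -
  have "poly (axis_poly (Suc n)) w = 
      (\<Sum>i=1..n + 2. w ^ i * (folded n (int i + 1) (int 1) + folded n (int i - 1) (int 1)))"
    by (simp add: axis_poly_at diag_walks_axis_Suc)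
  then show ?thesis using column_sum_shift[OF assms, of n "n + 2" 1] by simp
qed

lemma folded_0: "folded n 0 (int j) = diag_walks n (int j) 0"
  by (simp add: folded_def diag_walks_outside diag_walks_sym[of n 0])

lemma folded_1_0: "folded n 1 0 = 0"
  using diag_walks_parity1[of 1 n 0] diag_walks_parity2[of 0 n 1] by (auto simp: folded_def)

lemma coeff_axis_poly: "coeff (axis_poly n) j = diag_walks n (int j) 0"
  by (auto simp: axis_poly_def coeff_poly_upto diag_walks_outside diag_walks_support not_le)

definition column_poly :: "real \<Rightarrow> nat \<Rightarrow> real poly" where
  "column_poly w n = poly_upto (column_sum w n) (n + 1)"

definition first_column_poly :: "nat \<Rightarrow> real poly" where
  "first_column_poly n = poly_upto (\<lambda>j. folded n 1 (int j)) (n + 1)"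

lemma coeff_column_poly: "coeff (column_poly w n) j = (if j = 0 then 0 else column_sum w n j)"
  by (auto simp: column_poly_def coeff_poly_upto column_sum_def folded_support' not_le)

lemma coeff_first_column_poly: "coeff (first_column_poly n) j = folded n 1 (int j)"
  by (auto simp: first_column_poly_def coeff_poly_upto folded_1_0 folded_support' not_le)

lemma coeff_mult_1_plus_square:
  fixes p :: "'a::comm_ring_1 poly"
  shows "coeff ([:1, 0, 1:] * p) j = coeff p j + (if j < 2 then 0 else coeff p (j - 2))"
  by (auto simp: coeff_pCons split: nat.splits simp: numeral_2_eq_2 less_Suc_eq)

lemma column_poly_Suc:
  assumes w: "w \<noteq> 0"
  shows "[:0, 1:] * column_poly w (Suc n) = 
    [:w + 1/w:] * ([:1,0,1:] * column_poly w n + monom (2 * poly (axis_poly n) w) 2)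
    + [:w:] * ([:1,0,1:] * axis_poly n) - [:1,0,1:] * first_column_poly n 
    - monom (poly (axis_poly (Suc n)) w) 1"
proof (rule poly_eqI)
  fix j :: nat
  have m: "coeff ([:a:] * p) j = a * coeff p j" for a :: real and p by simp
  have x: "coeff ([:0,1:] * p) j = (case j of 0 \<Rightarrow> 0 | Suc i \<Rightarrow> coeff p i)" for p :: "real poly"
    by (simp add: coeff_pCons split: nat.splits)
  note coeffs = coeff_add coeff_diff m x coeff_mult_1_plus_square coeff_monom
  note more = coeff_column_poly coeff_first_column_poly coeff_axis_poly
  consider "j = 0" | "j = 1" | i where "j = Suc (Suc i)" by (metis One_nat_def not0_implies_Suc)
  then show "coeff ([:0, 1:] * column_poly w (Suc n)) j =
    coeff ([:w + 1/w:] * ([:1,0,1:] * column_poly w n + monom (2 * poly (axis_poly n) w) 2)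
    + [:w:] * ([:1,0,1:] * axis_poly n) - [:1,0,1:] * first_column_poly n 
    - monom (poly (axis_poly (Suc n)) w) 1) j"
  proof cases
    case 1
    show ?thesis unfolding coeffs 1 by (simp add: more folded_1_0 diag_walks_outside)
  next
    case 2
    show ?thesis unfolding coeffs 2 using axis_poly_at_Suc[OF w, of n] folded_0[of n 1] by (simp add: more)
  next
    case 3
    show ?thesis unfolding coeffs 3
      using column_sum_Suc[OF w, of n i] folded_0[of n i] folded_0[of n "i + 2"]
      by (simp add: more column_sum_0 algebra_simps)
  qed
qed

text \<open>Summing \<open>column_poly_Suc\<close> over \<open>n\<close> gives an equation for the folded generating function with the factor
  \<open>y - t (w + 1/w) (1 + y\<^sup>2)\<close>, which vanishes at \<open>Y\<close>. The unknown \<open>T\<close> and the series \<open>Y\<close> depend on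
  \<open>w\<close> through \<open>w + 1/w\<close> only.\<close>
lemma kernel_equation:
  fixes Y :: "real fps"
  assumes w: "w \<noteq> 0" and Y: "Y = fps_const (w + 1/w) * fps_X * (1 + Y\<^sup>2)"
  defines "L \<equiv> fps_ev fps_X (fps_const w) (Abs_fps axis_poly)"
    and "H \<equiv> fps_ev fps_X Y (Abs_fps axis_poly)" 
    and "T \<equiv> fps_ev fps_X Y (Abs_fps first_column_poly)"
  shows "fps_const w * Y\<^sup>2 + 2 * fps_const (w + 1/w) * fps_X * Y\<^sup>2 * L
    + fps_X * fps_const w * (1 + Y\<^sup>2) * H - fps_X * (1 + Y\<^sup>2) * T - Y * L = 0"
proof -
  define C where "C = Abs_fps (column_poly w)"
  define l where "l = Abs_fps (\<lambda>n. poly (axis_poly n) w)"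
  have L: "L = l"
    by (rule fps_ext) (simp add: L_def l_def fps_ev_def fps_peval_const fps_sum_nth 
        mult.commute[of _ "fps_const _"] if_distrib cong: if_cong)
  have "fps_const [:0,1:] * C = fps_const [:0,0,w:] + fps_X * (fps_const [:w + 1/w:] * 
      (fps_const [:1,0,1:] * C + fps_const [:0,0,2:] * fps_lift l) 
      + fps_const [:w:] * (fps_const [:1,0,1:] * Abs_fps axis_poly)
      - fps_const [:1,0,1:] * Abs_fps first_column_poly) - fps_const [:0,1:] * fps_lift l"
    (is "?L = ?R")
  proof (rule fps_ext)
    fix n
    show "?L $ n = ?R $ n"
    proof (cases n)
      case 0
      have "column_poly w 0 = [:0, w:]"
        by (rule poly_eqI) (auto simp: coeff_column_poly column_sum_def folded_def diag_walks.simps coeff_pCons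
            split: nat.splits)
      moreover have "poly (axis_poly 0) w = 0" by (simp add: axis_poly_at diag_walks.simps)
      ultimately show ?thesis using 0 by (simp add: C_def l_def fps_lift_def)
    next
      case (Suc m)
      have "[:0,0,2:] * [:a:] = monom (2 * a) 2" "[:0,1:] * [:a:] = monom a 1" for a :: real
        by (simp_all add: monom_altdef power2_eq_square)
      then show ?thesis unfolding Suc using column_poly_Suc[OF w, of m]
        by (simp add: C_def l_def fps_lift_def del: mult_pCons_left mult_pCons_right)
    qed
  qed
  then have "fps_ev fps_X Y ?L = fps_ev fps_X Y ?R" by (rule arg_cong)
  then have "Y * fps_ev fps_X Y C = fps_const w * Y\<^sup>2 + fps_X * (fps_const (w + 1/w) *
      ((1 + Y\<^sup>2) * fps_ev fps_X Y C + 2 * Y\<^sup>2 * L) 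
      + fps_const w * ((1 + Y\<^sup>2) * H) - (1 + Y\<^sup>2) * T) - Y * L"
    by (simp add: fps_ev_mult fps_ev_const fps_ev_X fps_ev_lift L H_def T_def power2_eq_square 
      algebra_simps numeral_fps_const)
  then show ?thesis using Y by algebra
qed

section \<open>The three-term functional equation\<close>

text \<open>\<open>Y\<close> is the compositional inverse of \<open>X / \<phi>\<close>.\<close>
lemma ex_fps_fixpoint:
  fixes \<phi> :: "'a::field fps"
  assumes "\<phi> $ 0 \<noteq> 0"
  shows "\<exists>Y. Y = fps_X * (\<phi> oo Y) \<and> Y $ 0 = 0"
proof -
  define f where "f = fps_X * inverse \<phi>"
  define Y where "Y = fps_inv f"
  have f: "f $ 0 = 0" "f $ 1 \<noteq> 0" using assms by (simp_all add: f_def)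
  have Y0: "Y $ 0 = 0" by (simp add: Y_def fps_inv_def)
  have "f oo Y = fps_X" unfolding Y_def by (rule fps_inv_right[OF f])
  moreover have "f oo Y = Y * inverse (\<phi> oo Y)"
    using Y0 assms by (simp add: f_def fps_compose_mult_distrib fps_inverse_compose)
  ultimately have "fps_X * (\<phi> oo Y) = Y * (inverse (\<phi> oo Y) * (\<phi> oo Y))" by (simp add: mult.assoc)
  also have "\<dots> = Y" using assms by (simp add: inverse_mult_eq_1)
  finally show ?thesis using Y0 by metis
qed

text \<open>The polynomial variable \<open>u\<close>.\<close>
definition U :: "real poly fps" where "U = fps_const [:0, 1:]"

text \<open>The numerator of \<open>M(u) = N(u) / (1 - u)\<close>, where \<open>\<eta>(u) = s u A(u)\<close> with \<open>A\<close> the axis series. The kernel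
  method yields a relation between \<open>\<eta>(u) - \<eta>(1/u)\<close> and \<open>\<eta>(v)\<close>; \<open>M\<close> is affine in \<open>\<eta>\<close>, with the
  rational coefficients in \<open>u\<close> that make this relation homogeneous and symmetric.\<close>
definition N_series :: "real poly fps" where
  "N_series = 1 + 2 * U + 3 * (1 + U) * (fps_X * U * axis_series)"

abbreviation ev2 :: "real fps \<Rightarrow> real poly fps \<Rightarrow> real fps" where
  "ev2 \<equiv> fps_ev (fps_X\<^sup>2)"

lemma X2_nth_0: "(fps_X\<^sup>2 :: real fps) $ 0 = 0" by simp

lemma ev_U [simp]: "fps_ev \<tau> y U = y"
  by (simp add: U_def fps_ev_const)

lemmas ev2_simps = fps_ev_mult[OF X2_nth_0] fps_ev_power[OF X2_nth_0] fps_ev_X[OF X2_nth_0]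
  fps_ev_lift[OF X2_nth_0]

lemma ev2_axis:
  "ev2 (y\<^sup>2) (fps_X * U * axis_series) = fps_X * fps_ev fps_X y (Abs_fps axis_poly)"
  unfolding ev2_simps axis_parity_split ev_U by (simp add: power2_eq_square mult.assoc)

lemma ev2_N: "ev2 y N_series = 1 + 2 * y + 3 * (1 + y) * ev2 y (fps_X * U * axis_series)"
  unfolding N_series_def fps_ev_add fps_ev_mult[OF X2_nth_0, of _ "3 * (1 + U)"]
  by (simp add: fps_ev_mult[OF X2_nth_0])

text \<open>This is \<open>M(u) + M(1/u) + M(v) = 0\<close> without denominators. The series \<open>v\<close> is the square of the root \<open>Y\<close> of the
  kernel at \<open>w = sqrt u\<close>; subtracting the kernel equations at \<open>w\<close> and \<open>1/w\<close> eliminates \<open>T\<close>.\<close>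
lemma functional_equation:
  fixes u :: real
  assumes u: "u > 0"
  obtains v :: "real fps" where
    "fps_const u * v = fps_const ((1 + u)\<^sup>2) * fps_X\<^sup>2 * (1 + v)\<^sup>2" "v $ 0 = 0"
    "(1 - v) * (ev2 (fps_const u) N_series - fps_const u * ev2 (fps_const (1 / u)) N_series)
    + fps_const (1 - u) * ev2 v N_series = 0"
proof -
  define w where "w = sqrt u"
  have w: "w \<noteq> 0" "w * w = u" using u by (simp_all add: w_def)
  define K where "K = w + 1 / w"
  have wK: "w * K = u + 1" using w by (simp add: K_def field_simps)
  have K0: "K \<noteq> 0" using wK u by (auto simp del: mult_eq_0_iff)
  obtain Y :: "real fps" where Y: "Y = fps_X * ((fps_const K + fps_const K * fps_X\<^sup>2) oo Y)" "Y $ 0 = 0"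
    using ex_fps_fixpoint[of "fps_const K + fps_const K * fps_X\<^sup>2"] K0 by auto
  have "(fps_const K + fps_const K * fps_X\<^sup>2) oo Y = fps_const K * (1 + Y\<^sup>2)"
    using Y(2) by (simp add: fps_compose_add_distrib fps_compose_mult_distrib
      fps_compose_power[symmetric] algebra_simps)
  then have Y1: "Y = fps_const K * fps_X * (1 + Y\<^sup>2)"
    using Y(1) by (simp add: algebra_simps)
  have K': "K = 1 / w + 1 / (1 / w)" by (simp add: K_def)
  define L where "L = fps_ev fps_X (fps_const w) (Abs_fps axis_poly)"
  define L' where "L' = fps_ev fps_X (fps_const (1 / w)) (Abs_fps axis_poly)"
  define H where "H = fps_ev fps_X Y (Abs_fps axis_poly)"
  define T where "T = fps_ev fps_X Y (Abs_fps first_column_poly)"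
  have k1: "fps_const w * Y\<^sup>2 + 2 * fps_const K * fps_X * Y\<^sup>2 * L
    + fps_X * fps_const w * (1 + Y\<^sup>2) * H - fps_X * (1 + Y\<^sup>2) * T - Y * L = 0"
    using kernel_equation[OF w(1) Y1[unfolded K_def]] unfolding K_def L_def H_def T_def .
  have k2: "fps_const (1 / w) * Y\<^sup>2 + 2 * fps_const K * fps_X * Y\<^sup>2 * L'
    + fps_X * fps_const (1 / w) * (1 + Y\<^sup>2) * H - fps_X * (1 + Y\<^sup>2) * T - Y * L' = 0"
    using kernel_equation[OF _ Y1[unfolded K']] w unfolding L'_def H_def T_def K' by simp
  define W where "W = fps_const w" 
  define W' where "W' = fps_const (1 / w)"
  have W: "W * W' = 1" "W * W = fps_const u" "fps_const K = W + W'" "W' * W' = fps_const (1 / u)"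
    using w by (simp_all add: W_def W'_def K_def flip: w(2))
  have sq: "(fps_const w)\<^sup>2 = fps_const u" "(fps_const (1 / w))\<^sup>2 = fps_const (1 / u)"
    using w by (simp_all add: power2_eq_square)
  let ?n1 = "ev2 (fps_const u) N_series" and ?n2 = "ev2 (fps_const (1 / u)) N_series"
    and ?n3 = "ev2 (Y\<^sup>2) N_series"
  have n: "?n1 = 1 + 2 * fps_const u + 3 * (1 + fps_const u) * (fps_X * L)"
    "?n2 = 1 + 2 * fps_const (1 / u) + 3 * (1 + fps_const (1 / u)) * (fps_X * L')"
    "?n3 = 1 + 2 * Y\<^sup>2 + 3 * (1 + Y\<^sup>2) * (fps_X * H)"
    using ev2_axis[of "fps_const w"] ev2_axis[of "fps_const (1 / w)"] ev2_axis[of Y]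
    unfolding ev2_N sq L_def L'_def H_def by simp_all
  define D where "D = L - L'"
  have 1: "(W - W') * Y\<^sup>2 + (2 * (W + W') * fps_X * Y\<^sup>2 - Y) * D + fps_X * (W - W') * (1 + Y\<^sup>2) * H = 0"
    using k1 k2 unfolding W(3) D_def W_def[symmetric] W'_def[symmetric] by algebra
  have Y2: "Y = (W + W') * fps_X * (1 + Y\<^sup>2)" using Y1 W(3) by simp
  have 2: "(W - W') * Y\<^sup>2 + (W + W') * (Y\<^sup>2 - 1) * fps_X * D + fps_X * (W - W') * (1 + Y\<^sup>2) * H = 0"
    using 1 Y2 by algebra
  show ?thesis
  proof (rule that[of "Y\<^sup>2"])
    show "fps_const u * Y\<^sup>2 = fps_const ((1 + u)\<^sup>2) * fps_X\<^sup>2 * (1 + Y\<^sup>2)\<^sup>2"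
    proof -
      have "fps_const ((1 + u)\<^sup>2) = (1 + W * W)\<^sup>2"
        unfolding W(2) by (simp add: power2_eq_square fps_const_mult[symmetric] fps_const_add[symmetric] del: fps_const_mult fps_const_add)
      then show ?thesis unfolding W(2)[symmetric] using Y2 W(1) by algebra
    qed
    show "(Y\<^sup>2) $ 0 = 0" using Y(2) by (simp add: power2_eq_square)
    have c1: "fps_const (1 - u) = 1 - W * W" by (simp add: W fps_const_sub[symmetric] del: fps_const_sub)
    show "(1 - Y\<^sup>2) * (?n1 - fps_const u * ?n2) + fps_const (1 - u) * ?n3 = 0"
      unfolding n unfolding c1 W(2,4)[symmetric] using 2 W(1) D_def by algebra
  qed
qed

section \<open>The cubic equation\<close>

text \<open>The zeros of \<open>4M\<^sup>3 - 3M - 1 = (M - 1)(2M + 1)\<^sup>2\<close> at \<open>u = 0\<close> and \<open>u = -1\<close> cancel the poles of \<open>j\<close> there: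
  \<open>N - (1 - u) = 3uA\<close> and \<open>2N + (1 - u) = 3(1 + u)B\<close>.\<close>
definition A_series :: "real poly fps" where "A_series = 1 + (1 + U) * fps_X * axis_series"
definition B_series :: "real poly fps" where "B_series = 1 + 2 * fps_X * U * axis_series"

definition eval_at :: "real \<Rightarrow> real poly fps \<Rightarrow> real fps" where "eval_at x = fps_ev fps_X (fps_const x)"

lemma eval_at_nth: "eval_at x F $ n = poly (F $ n) x"
  by (simp add: eval_at_def fps_ev_def fps_peval_const fps_sum_nth mult.commute[of _ "fps_const _"] 
     if_distrib cong: if_cong)

text \<open>Determined by \<open>\<Theta>(1) = 0\<close>; \<open>\<delta>\<close> is then determined by \<open>\<Theta>(0) = 0\<close>.\<close>
definition \<beta> :: "real fps" where
  "\<beta> = fps_const (9/16) * (1 - 16 * fps_X) * (eval_at 1 B_series)\<^sup>2"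
definition \<delta> :: "real fps" where
  "\<delta> = - \<beta> - fps_const (27/4) * fps_X * eval_at 0 A_series"

text \<open>The cubic expression times \<open>1 - u\<close>, with the common factor \<open>u (1 + u)\<^sup>2\<close> cancelled, so that it is a series with
  polynomial coefficients.\<close>
definition \<Theta> :: "real poly fps" where
  "\<Theta> = 27 * (4 * fps_X * (1 + U)\<^sup>2 - U) * A_series * B_series\<^sup>2
     + 16 * (fps_lift \<beta> * N_series + fps_lift \<delta> * (1 - U))"

lemma X_nth_0: "(fps_X :: real fps) $ 0 = 0" by simp

lemmas ev_simps = fps_ev_mult[OF X_nth_0] fps_ev_power[OF X_nth_0] fps_ev_X[OF X_nth_0]
  fps_ev_lift[OF X_nth_0]

lemma cubic_form:
  "U * (1 + U)\<^sup>2 * \<Theta> = (4 * fps_X * (1 + U)\<^sup>2 - U) *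
      (4 * N_series ^ 3 - 3 * N_series * (1 - U)\<^sup>2 - (1 - U) ^ 3)
    + 16 * U * (1 + U)\<^sup>2 * (fps_lift \<beta> * N_series + fps_lift \<delta> * (1 - U))"
proof -
  have 1: "N_series - (1 - U) = 3 * U * A_series"
    unfolding N_series_def A_series_def by algebra
  have 2: "2 * N_series + (1 - U) = 3 * (1 + U) * B_series"
    unfolding N_series_def B_series_def by algebra
  have "4 * N_series ^ 3 - 3 * N_series * (1 - U)\<^sup>2 - (1 - U) ^ 3
      = (N_series - (1 - U)) * (2 * N_series + (1 - U))\<^sup>2" by algebra
  also have "\<dots> = 27 * U * (1 + U)\<^sup>2 * A_series * B_series\<^sup>2" unfolding 1 2 by algebra
  finally have E: "4 * N_series ^ 3 - 3 * N_series * (1 - U)\<^sup>2 - (1 - U) ^ 3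
      = 27 * U * (1 + U)\<^sup>2 * A_series * B_series\<^sup>2" .
  show ?thesis unfolding \<Theta>_def E by algebra
qed

lemma fps_numeral_split: "(numeral n :: real fps) = fps_const (numeral n)" 
  by (simp add: numeral_fps_const)

lemma \<Theta>_at_1: "eval_at 1 \<Theta> = 0"
proof -
  let ?a = "eval_at 1 axis_series"
  have e: "eval_at 1 \<Theta> = 27 * (16 * fps_X - 1) * (1 + 2 * fps_X * ?a) * (1 + 2 * fps_X * ?a)\<^sup>2 
     + 48 * \<beta> * (1 + 2 * fps_X * ?a)"
    by (simp add: eval_at_def \<Theta>_def A_series_def B_series_def N_series_def ev_simps power2_eq_square)
  have b: "\<beta> = fps_const (9/16) * (1 - 16 * fps_X) * (1 + 2 * fps_X * ?a)\<^sup>2"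
    by (simp add: \<beta>_def B_series_def eval_at_def ev_simps)
  define k :: "real fps" where "k = fps_const (9/16)"
  have "48 * k = 27" by (simp add: k_def numeral_fps_const)
  have "eval_at 1 \<Theta> = (48 * k - 27) * ((1 - 16 * fps_X) * (1 + 2 * fps_X * ?a) ^ 3)"
    unfolding e b k_def[symmetric] by algebra
  then show ?thesis using \<open>48 * k = 27\<close> by simp
qed

lemma \<Theta>_at_0: "eval_at 0 \<Theta> = 0"
proof -
  have e: "eval_at 0 \<Theta> = 27 * (4 * fps_X) * eval_at 0 A_series + 16 * (\<beta> + \<delta>)"
    by (simp add: eval_at_def \<Theta>_def B_series_def N_series_def ev_simps)
  define k :: "real fps" where "k = fps_const (27/4)"
  have "16 * k = 108" by (simp add: k_def numeral_fps_const)
  have "eval_at 0 \<Theta> = (108 - 16 * k) * (fps_X * eval_at 0 A_series)"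
    unfolding e \<delta>_def k_def[symmetric] by algebra
  then show ?thesis using \<open>16 * k = 108\<close> by simp
qed

lemma \<Theta>_minus_1: "eval_at (- 1) \<Theta> = 0 \<longleftrightarrow> 
  27 * (1 - 2 * fps_X * eval_at (- 1) axis_series)\<^sup>2 = 16 * (\<beta> - 2 * \<delta>)"
proof -
  have m1: "fps_const (- 1) = (- 1 :: real fps)" by (simp flip: fps_const_neg)
  have "eval_at (- 1) \<Theta> = 27 * (1 - 2 * fps_X * eval_at (- 1) axis_series)\<^sup>2 - 16 * (\<beta> - 2 * \<delta>)"
    unfolding eval_at_def m1
    by (simp add: \<Theta>_def A_series_def B_series_def N_series_def ev_simps algebra_simps)
  then show ?thesis by auto
qed

text \<open>Modulo the cubic with roots \<open>m1\<close>, \<open>m2\<close>, \<open>m3\<close>, which has no quadratic term, each \<open>f\<close> is an affine function of its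
  \<open>m\<close> with the same coefficients. Hence the three points \<open>(m, f)\<close> are collinear, which is the conclusion.\<close>
lemma determinant_relation:
  fixes m1 m2 m3 :: "'a::idom"
  assumes "m1 + m2 + m3 = 0"
    and "f1 = j * (4 * m1 ^ 3 - 3 * m1 - 1) + 16 * (b * m1 + d)"
    and "f2 = j * (4 * m2 ^ 3 - 3 * m2 - 1) + 16 * (b * m2 + d)"
    and "f3 = j * (4 * m3 ^ 3 - 3 * m3 - 1) + 16 * (b * m3 + d)"
  shows "f1 * (m1 + 2 * m2) - f2 * (m2 + 2 * m1) = f3 * (m2 - m1)"
proof -
  have m3: "m3 = - m1 - m2" using assms(1) by algebra
  show ?thesis unfolding assms(2-4) m3 by algebra
qed

text \<open>If \<open>F\<close> begins with \<open>s^n\<close>, then the lowest term after \<open>s \<mapsto> t\<^sup>2\<close> is \<open>t^(2n)\<close>, and its coefficient sees only the constant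
  term of \<open>y\<close>.\<close>
lemma ev2_lowest:
  assumes "\<And>k. k < n \<Longrightarrow> F $ k = 0"
  shows "i < 2 * n \<Longrightarrow> ev2 y F $ i = 0" "ev2 y F $ (2 * n) = poly (F $ n) (y $ 0)"
proof -
  have X: "((fps_X\<^sup>2) ^ k * g :: real fps) $ i = (if i < 2 * k then 0 else g $ (i - 2 * k))" for k i g
    unfolding power_mult[symmetric] by (simp add: fps_X_power_mult_nth)
  have e: "ev2 y F $ i = (\<Sum>k\<le>i. if i < 2 * k then 0 else fps_peval (F $ k) y $ (i - 2 * k))" for i
    unfolding fps_ev_def by (simp only: fps_nth_Abs_fps fps_sum_nth X)
  have z: "(if i < 2 * k then 0 else fps_peval (F $ k) y $ (i - 2 * k)) = 0" 
    if "i < 2 * n \<or> i = 2 * n \<and> k \<noteq> n" for i k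
    using that assms[of k] by (cases "k < n") (auto simp: not_less)
  show "ev2 y F $ i = 0" if "i < 2 * n" 
    unfolding e using that z by (intro sum.neutral) blast
  have "ev2 y F $ (2 * n) = (\<Sum>k\<le>2*n. if k = n then fps_peval (F $ n) y $ 0 else 0)"
    unfolding e
  proof (intro sum.cong refl)
    fix k
    show "(if 2 * n < 2 * k then 0 else fps_peval (F $ k) y $ (2 * n - 2 * k)) =
      (if k = n then fps_peval (F $ n) y $ 0 else 0)"
      using z[of "2 * n" k] by (cases "k = n") auto
  qed
  then show "ev2 y F $ (2 * n) = poly (F $ n) (y $ 0)" by (simp add: fps_peval_nth_0)
qed

lemma fps_mult_nth_lowest:
  fixes f g :: "'a::comm_ring_1 fps"
  assumes "\<And>i. i < n \<Longrightarrow> f $ i = 0"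
  shows "(f * g) $ n = f $ n * g $ 0"
proof -
  have "(f * g) $ n = (\<Sum>i=0..n. if i = n then f $ n * g $ 0 else 0)"
    unfolding fps_mult_nth using assms by (intro sum.cong) auto
  then show ?thesis by simp
qed

lemma fps_mult_nth_below:
  fixes f g :: "'a::comm_ring_1 fps"
  assumes "\<And>i. i < n \<Longrightarrow> f $ i = 0" "k < n"
  shows "(f * g) $ k = 0"
  unfolding fps_mult_nth using assms by (intro sum.neutral) auto

text \<open>For \<open>u\<close> tending to infinity, \<open>p(u) / u\<^sup>2 = p(1/u)\<close> tends to \<open>p(0) = 0\<close>, so \<open>p\<close> has degree at most \<open>1\<close> and two
  zeros. The proof compares degrees in the corresponding polynomial identity.\<close>
lemma palindromic_vanishing:
  fixes p :: "real poly"
  assumes "\<And>u. u > 0 \<Longrightarrow> u \<noteq> 1 \<Longrightarrow> poly p u = u\<^sup>2 * poly p (1 / u)"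
    and p0: "poly p 0 = 0" and p1: "poly p 1 = 0"
  shows "p = 0"
proof (rule ccontr)
  assume nz: "p \<noteq> 0"
  let ?d = "degree p"
  have "monom 1 ?d * p = [:0,0,1:] * reflect_poly p"
  proof (rule ccontr)
    let ?q = "monom 1 ?d * p - [:0,0,1:] * reflect_poly p"
    assume "\<not> ?thesis"
    then have fin: "finite {u. poly ?q u = 0}" by (intro poly_roots_finite) simp
    have "{1<..<2} \<subseteq> {u. poly ?q u = 0}"
    proof
      fix u :: real assume "u \<in> {1<..<2}"
      then have u: "u > 0" "u \<noteq> 1" by auto
      have "u ^ ?d * poly p u = u\<^sup>2 * (u ^ ?d * poly p (inverse u))"
        using assms(1)[OF u] by (simp add: inverse_eq_divide)
      then show "u \<in> {u. poly ?q u = 0}" using u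
        by (simp add: poly_monom poly_reflect_poly_nz power2_eq_square algebra_simps)
    qed
    then show False using fin infinite_Ioo[of 1 "2::real"] finite_subset by (metis one_less_numeral_iff semiring_norm(76))
  qed
  then have eq: "degree (monom 1 ?d * p) = degree ([:0,0,1:] * reflect_poly p)" by simp
  obtain q where q: "p = pCons 0 q" using p0 by (cases p) auto
  have "reflect_poly p = reflect_poly q"
  proof -
    have "p = [:0, 1:] * q" using q by simp
    moreover have "reflect_poly [:0, 1::real:] = 1" by (simp add: reflect_poly_def)
    ultimately show ?thesis by (simp only: reflect_poly_mult mult_1_left)
  qed
  moreover have "degree (reflect_poly q) \<le> degree q" by (rule degree_reflect_poly_le)
  moreover have "q \<noteq> 0" using q nz by auto
  moreover have "degree (monom 1 ?d * p) = 2 * ?d" using nz by (simp add: degree_mult_eq degree_monom_eq)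
  moreover have "degree ([:0,0,1:] * reflect_poly p) = 2 + degree (reflect_poly p)" using nz by (subst degree_mult_eq) auto
  ultimately have "degree q = 0" using eq q by simp
  then obtain a where "q = [:a:]" by (metis degree_eq_zeroE)
  then show False using p1 q nz by simp
qed

lemma lowest_coefficient_relation:
  fixes u A B :: real
  assumes u: "u > 0" "u \<noteq> 1"
    and e: "A / (1 - u) * ((1 + 2 * u) / (1 - u) + 2 * ((1 + 2 / u) / (1 - 1 / u)))
      - B / (1 - 1 / u) * ((1 + 2 / u) / (1 - 1 / u) + 2 * ((1 + 2 * u) / (1 - u))) = 0"
  shows "A = u\<^sup>2 * B"
proof -
  define d where "d = inverse (1 - u)"
  have d: "d * (1 - u) = 1" "d \<noteq> 0" using u by (simp_all add: d_def)
  have i: "inverse (1 - 1 / u) = - u * d"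
    using u by (simp add: d_def divide_simps) (simp add: algebra_simps)
  have 1: "(1 + 2 / u) * (- u * d) = - (u + 2) * d" using u by (simp add: field_simps)
  have 2: "(1 + 2 * u) * d + 2 * (- (u + 2) * d) = - 3 * d" "- (u + 2) * d + 2 * ((1 + 2 * u) * d) = 3 * u * d"
    by (simp_all add: algebra_simps)
  have "A * d * (- 3 * d) - B * (- u * d) * (3 * u * d) = 0"
    using e unfolding divide_inverse[of _ "1 - u"] divide_inverse[of _ "1 - 1 / u"] i
      d_def[symmetric] 1 2 .
  then have "3 * d * d * (u\<^sup>2 * B - A) = 0" by (simp add: algebra_simps power2_eq_square)
  then show ?thesis using d by simp
qed

text \<open>The induction step for \<open>\<Theta> = 0\<close>: the determinant relation for the points \<open>u\<close>, \<open>1/u\<close>, \<open>v\<close>, read off at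
  its lowest coefficient. There \<open>v\<close> contributes nothing, because \<open>v\<close> has no constant term and \<open>\<Theta>(0) = 0\<close>.\<close>
lemma \<Theta>_eq_0_step:
  fixes u :: real
  assumes IH: "\<And>k. k < n \<Longrightarrow> \<Theta> $ k = 0" and u: "u > 0" "u \<noteq> 1"
  shows "poly (\<Theta> $ n) u = u\<^sup>2 * poly (\<Theta> $ n) (1 / u)"
proof -
  obtain v :: "real fps" where v: "fps_const u * v = fps_const ((1 + u)\<^sup>2) * fps_X\<^sup>2 * (1 + v)\<^sup>2" "v $ 0 = 0"
    "(1 - v) * (ev2 (fps_const u) N_series - fps_const u * ev2 (fps_const (1 / u)) N_series)
    + fps_const (1 - u) * ev2 v N_series = 0"
    using functional_equation[OF u(1)] by blast
  define b where "b = \<beta> oo fps_X\<^sup>2"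
  define d where "d = \<delta> oo fps_X\<^sup>2"
  define Xc where "Xc = fps_const ((1 + u)\<^sup>2 / u)"
  \<comment> \<open>\<open>Xc = (1 + u)\<^sup>2 / u\<close> is invariant under \<open>u \<mapsto> 1/u\<close>, while passing from \<open>u\<close> to \<open>v\<close> replaces it by \<open>1 / (t\<^sup>2 Xc)\<close>; \<open>j\<close> is
    a polynomial in \<open>t\<^sup>2 Xc + 1/Xc\<close>.\<close>
  define j where "j = fps_const (inverse ((1 + u)\<^sup>2 / u)) * ((Xc - 4) * (4 * fps_X\<^sup>2 * Xc - 1))"
  have cu: "(1 + u)\<^sup>2 / u \<noteq> 0" using u by (simp add: power2_eq_square)
  have j: "j * Xc = (Xc - 4) * (4 * fps_X\<^sup>2 * Xc - 1)"
  proof -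
    have "fps_const (inverse ((1 + u)\<^sup>2 / u)) * Xc = 1" using cu by (simp add: Xc_def)
    then show ?thesis unfolding j_def by (simp add: mult_ac)
  qed
  have Xc0: "Xc \<noteq> 0" using cu by (simp add: Xc_def)
  define m where "m y = ev2 y N_series * inverse (1 - y)" for y
  define f where "f y = ev2 y \<Theta> * inverse (1 - y)" for y
  \<comment> \<open>\<open>m y\<close> is \<open>M(y)\<close>, and \<open>f y\<close> is \<open>\<Theta>(y) / (1 - y)\<close>; the points \<open>y\<close> share the value \<open>j\<close>.\<close>
  have main: "f y = j * (4 * m y ^ 3 - 3 * m y - 1) + 16 * (b * m y + d)"
    and N: "ev2 y N_series = (1 - y) * m y" 
    if y: "y $ 0 \<noteq> 1" "y $ 0 \<noteq> -1" "y \<noteq> 0" "(1 - y)\<^sup>2 * (4 * fps_X\<^sup>2 * (1 + y)\<^sup>2 - y) = j * y * (1 + y)\<^sup>2" for y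
  proof -
    have i: "(1 - y) * inverse (1 - y) = 1" using y(1) by (simp add: inverse_mult_eq_1')
    show N: "ev2 y N_series = (1 - y) * m y" using i by (simp add: m_def mult_ac)
    have F: "ev2 y \<Theta> = (1 - y) * f y" using i by (simp add: f_def mult_ac)
    have "1 + y \<noteq> 0" using y(2) by (metis add_eq_0_iff fps_add_nth fps_one_nth fps_zero_nth minus_minus)
    have "ev2 y (U * (1 + U)\<^sup>2 * \<Theta>) = ev2 y ((4 * fps_X * (1 + U)\<^sup>2 - U) *
      (4 * N_series ^ 3 - 3 * N_series * (1 - U)\<^sup>2 - (1 - U) ^ 3)
    + 16 * U * (1 + U)\<^sup>2 * (fps_lift \<beta> * N_series + fps_lift \<delta> * (1 - U)))"
      by (simp only: cubic_form)
    then have "y * (1 + y)\<^sup>2 * ((1 - y) * f y) = (4 * fps_X\<^sup>2 * (1 + y)\<^sup>2 - y) *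
      (4 * ((1 - y) * m y) ^ 3 - 3 * ((1 - y) * m y) * (1 - y)\<^sup>2 - (1 - y) ^ 3)
      + 16 * y * (1 + y)\<^sup>2 * (b * ((1 - y) * m y) + d * (1 - y))"
      by (simp only: ev2_simps fps_ev_add fps_ev_diff fps_ev_1 fps_ev_numeral ev_U N F b_def d_def)
    then have "(y * (1 + y)\<^sup>2 * (1 - y)) * f y = 
       (y * (1 + y)\<^sup>2 * (1 - y)) * (j * (4 * m y ^ 3 - 3 * m y - 1) + 16 * (b * m y + d))"
      (is "?l = ?r")
    proof -
      assume e: "y * (1 + y)\<^sup>2 * ((1 - y) * f y) = (4 * fps_X\<^sup>2 * (1 + y)\<^sup>2 - y) *
        (4 * ((1 - y) * m y) ^ 3 - 3 * ((1 - y) * m y) * (1 - y)\<^sup>2 - (1 - y) ^ 3)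
        + 16 * y * (1 + y)\<^sup>2 * (b * ((1 - y) * m y) + d * (1 - y))"
      have "?l = y * (1 + y)\<^sup>2 * ((1 - y) * f y)" by algebra
      also have "\<dots> = ((1 - y)\<^sup>2 * (4 * fps_X\<^sup>2 * (1 + y)\<^sup>2 - y)) * ((1 - y) * (4 * m y ^ 3 - 3 * m y - 1))
        + 16 * y * (1 + y)\<^sup>2 * (b * ((1 - y) * m y) + d * (1 - y))"
        unfolding e by algebra
      also have "\<dots> = ?r" unfolding y(4) by algebra
      finally show ?thesis .
    qed
    moreover have "y * (1 + y)\<^sup>2 * (1 - y) \<noteq> 0" using y(3) \<open>1 + y \<noteq> 0\<close> y(1) by auto
    ultimately show "f y = j * (4 * m y ^ 3 - 3 * m y - 1) + 16 * (b * m y + d)"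
      using mult_left_cancel by blast
  qed
  let ?u = "fps_const u" and ?u' = "fps_const (1 / u)"
  have uX: "Xc * ?u = (1 + ?u)\<^sup>2" "Xc * ?u' = (1 + ?u')\<^sup>2" "?u * ?u' = 1"
    using u by (simp_all add: Xc_def power2_eq_square field_simps fps_const_add[symmetric] fps_const_mult[symmetric] del: fps_const_add fps_const_mult flip: fps_const_1_eq_1)
  have vX: "v = Xc * fps_X\<^sup>2 * (1 + v)\<^sup>2"
  proof -
    have "?u * Xc = fps_const ((1 + u)\<^sup>2)" using u by (simp add: Xc_def)
    then have "?u * v = ?u * (Xc * fps_X\<^sup>2 * (1 + v)\<^sup>2)" unfolding v(1) by (simp flip: mult.assoc)
    then show ?thesis using u by simp
  qed
  have c1: "(1 - y)\<^sup>2 * (4 * fps_X\<^sup>2 * (1 + y)\<^sup>2 - y) = j * y * (1 + y)\<^sup>2" if "Xc * y = (1 + y)\<^sup>2" for y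
  proof -
    have "(1 - y)\<^sup>2 = (1 + y)\<^sup>2 - 4 * y" by algebra
    then have "(1 - y)\<^sup>2 * (4 * fps_X\<^sup>2 * (1 + y)\<^sup>2 - y) = (Xc * y - 4 * y) * (4 * fps_X\<^sup>2 * (Xc * y) - y)"
      unfolding that by simp
    also have "\<dots> = y * y * (j * Xc)" unfolding j by algebra
    also have "\<dots> = j * y * (1 + y)\<^sup>2" unfolding that[symmetric] by algebra
    finally show ?thesis .
  qed
  have c2: "(1 - v)\<^sup>2 * (4 * fps_X\<^sup>2 * (1 + v)\<^sup>2 - v) = j * v * (1 + v)\<^sup>2"
  proof -
    have "(1 - v)\<^sup>2 = (1 + v)\<^sup>2 - 4 * v" by algebra
    also have "\<dots> = (1 + v)\<^sup>2 * (1 - 4 * Xc * fps_X\<^sup>2)" using vX by algebra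
    finally have 1: "(1 - v)\<^sup>2 = (1 + v)\<^sup>2 * (1 - 4 * Xc * fps_X\<^sup>2)" .
    have 2: "4 * fps_X\<^sup>2 * (1 + v)\<^sup>2 - v = fps_X\<^sup>2 * (1 + v)\<^sup>2 * (4 - Xc)" using vX by algebra
    have "(1 - v)\<^sup>2 * (4 * fps_X\<^sup>2 * (1 + v)\<^sup>2 - v) = fps_X\<^sup>2 * (1 + v)\<^sup>2 * (1 + v)\<^sup>2 * (j * Xc)"
      unfolding 1 2 j by algebra
    also have "\<dots> = j * (Xc * fps_X\<^sup>2 * (1 + v)\<^sup>2) * (1 + v)\<^sup>2" by algebra
    finally show ?thesis using vX by simp
  qed
  have v0: "v \<noteq> 0" using vX cu by (auto simp: Xc_def)
  note M1 = main[of ?u] N[of ?u] and M2 = main[of ?u'] N[of ?u'] and M3 = main[of v] N[of v]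
  have inv: "1 / u > 0" "1 / u \<noteq> 1" "1 / u \<noteq> - 1"
    using u by (simp_all, metis divide_pos_pos less_minus_one_simps(3) not_less_iff_gr_or_eq zero_less_one)
  have g1: "f ?u = j * (4 * m ?u ^ 3 - 3 * m ?u - 1) + 16 * (b * m ?u + d)"
    "ev2 ?u N_series = (1 - ?u) * m ?u" using M1 c1[OF uX(1)] u by auto
  have g2: "f ?u' = j * (4 * m ?u' ^ 3 - 3 * m ?u' - 1) + 16 * (b * m ?u' + d)"
    "ev2 ?u' N_series = (1 - ?u') * m ?u'" using M2 c1[OF uX(2)] u inv by auto
  have g3: "f v = j * (4 * m v ^ 3 - 3 * m v - 1) + 16 * (b * m v + d)"
    "ev2 v N_series = (1 - v) * m v" using M3 c2 v0 v(2) by auto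
  have "(1 - v) * (1 - ?u) * (m ?u + m ?u' + m v) = 0"
  proof -
    have "?u * (1 - ?u') = ?u - 1" using uX(3) by (simp add: right_diff_distrib)
    then have *: "?u * ((1 - ?u') * m ?u') = (?u - 1) * m ?u'" by (simp flip: mult.assoc)
    have "fps_const (1 - u) = 1 - ?u" by (simp flip: fps_const_sub)
    then show ?thesis using v(3) unfolding g1(2) g2(2) g3(2) * by algebra
  qed
  moreover have "1 - v \<noteq> 0" using v(2) by auto
  moreover have "1 - ?u \<noteq> 0" using u(2) by auto
  ultimately have "m ?u + m ?u' + m v = 0" by simp
  from determinant_relation[OF this g1(1) g2(1) g3(1)]
  have D: "(f ?u * (m ?u + 2 * m ?u') - f ?u' * (m ?u' + 2 * m ?u)) $ (2 * n) = (f v * (m ?u' - m ?u)) $ (2 * n)"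
    by (rule arg_cong)
  have fl: "f y $ i = 0" if "i < 2 * n" for i y
    unfolding f_def using ev2_lowest(1)[OF IH] that by (intro fps_mult_nth_below[of "2 * n"]) auto
  have ft: "f y $ (2 * n) = poly (\<Theta> $ n) (y $ 0) / (1 - y $ 0)" for y
    unfolding f_def using ev2_lowest[OF IH]
    by (subst fps_mult_nth_lowest) (auto simp: divide_inverse)
  have m0: "m y $ 0 = (1 + 2 * y $ 0) / (1 - y $ 0)" for y
    by (simp add: m_def ev2_N ev2_simps divide_inverse fps_numeral_split)
  have "poly (\<Theta> $ n) 0 = 0" using \<Theta>_at_0 eval_at_nth[of 0 \<Theta> n] by simp
  then have "f v $ (2 * n) = 0" using ft[of v] v(2) by simp
  moreover have "(f y * g) $ (2 * n) = f y $ (2 * n) * g $ 0" for y g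
    by (rule fps_mult_nth_lowest) (rule fl)
  ultimately have "f ?u $ (2 * n) * (m ?u $ 0 + 2 * m ?u' $ 0)
      - f ?u' $ (2 * n) * (m ?u' $ 0 + 2 * m ?u $ 0) = 0"
    using D by simp
  then have "poly (\<Theta> $ n) u / (1 - u) * ((1 + 2 * u) / (1 - u) + 2 * ((1 + 2 / u) / (1 - 1 / u)))
    - poly (\<Theta> $ n) (1 / u) / (1 - 1 / u) * ((1 + 2 / u) / (1 - 1 / u) + 2 * ((1 + 2 * u) / (1 - u))) = 0"
    by (simp add: ft m0)
  then show ?thesis by (rule lowest_coefficient_relation[OF u])
qed

lemma \<Theta>_eq_0: "\<Theta> = 0"
proof (rule fps_ext)
  fix n show "\<Theta> $ n = 0 $ n"
  proof (induction n rule: less_induct)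
    case (less n)
    have "poly (\<Theta> $ n) 0 = 0" using \<Theta>_at_0 eval_at_nth[of 0 \<Theta> n] by simp
    moreover have "poly (\<Theta> $ n) 1 = 0" using \<Theta>_at_1 eval_at_nth[of 1 \<Theta> n] by simp
    moreover have "\<Theta> $ k = 0" if "k < n" for k using less.IH[OF that] by (simp only: fps_zero_nth)
    then have pal: "poly (\<Theta> $ n) u = u\<^sup>2 * poly (\<Theta> $ n) (1 / u)" if "u > 0" "u \<noteq> 1" for u
      using that by (rule \<Theta>_eq_0_step)
    ultimately have "\<Theta> $ n = 0" by (intro palindromic_vanishing)
    then show ?case by simp
  qed
qed

section \<open>Double roots and the discriminant\<close>

lemma fps_pderiv_1: "fps_pderiv 1 = 0"
  by (rule fps_ext) (simp add: fps_pderiv_def)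

lemma fps_pderiv_numeral: "fps_pderiv (numeral n) = 0"
  by (rule fps_ext) (simp add: fps_pderiv_def fps_numeral_nth)

lemma fps_pderiv_U: "fps_pderiv U = 1"
  by (simp add: U_def fps_pderiv_const pderiv_pCons)

text \<open>\<open>E1\<close> is the cubic equation at \<open>y\<close> and \<open>E2\<close> its derivative with respect to \<open>u\<close>, where \<open>n'\<close> is the derivative of
  \<open>n\<close>. Since \<open>y = t (1 + y)\<^sup>2\<close> is a critical point of \<open>j\<close> and the derivative of \<open>M = n / v\<close>, which is \<open>(v n' + n) / v\<^sup>2\<close>, does
  not vanish, the cubic has a vanishing derivative with respect to \<open>M\<close> as well.\<close>
lemma double_root:
  fixes y n n' v t b d :: "'a::idom"
  assumes y: "y = t * (1 + y)\<^sup>2" and v: "v = 1 - y"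
    and C: "C = 4 * n ^ 3 - 3 * n * v\<^sup>2 - v ^ 3"
    and E1: "(4 * t\<^sup>2 * (1 + y)\<^sup>2 - y) * C + 16 * y * (1 + y)\<^sup>2 * (b * n + d * v) = 0"
    and E2: "(8 * t\<^sup>2 * (1 + y) - 1) * C
      + (4 * t\<^sup>2 * (1 + y)\<^sup>2 - y) * (12 * n\<^sup>2 * n' - 3 * n' * v\<^sup>2 + 6 * n * v + 3 * v\<^sup>2)
      + 16 * ((1 + y) * (1 + 3 * y) * (b * n + d * v) + y * (1 + y)\<^sup>2 * (b * n' - d)) = 0"
    and nz: "y \<noteq> 0" "1 + y \<noteq> 0" "v * n' + n \<noteq> 0"
  shows "(4 * t - 1) * C + 16 * (1 + y)\<^sup>2 * (b * n + d * v) = 0"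
    and "(4 * t - 1) * (12 * n\<^sup>2 - 3 * v\<^sup>2) + 16 * (1 + y)\<^sup>2 * b = 0"
proof -
  have q: "4 * t\<^sup>2 * (1 + y)\<^sup>2 - y = y * (4 * t - 1)"
  proof -
    have "4 * t\<^sup>2 * (1 + y)\<^sup>2 - y = 4 * t * (t * (1 + y)\<^sup>2) - y" by algebra
    also have "\<dots> = 4 * t * y - y" using y by simp
    finally show ?thesis by algebra
  qed
  have "y * ((4 * t - 1) * C + 16 * (1 + y)\<^sup>2 * (b * n + d * v)) =
      y * (4 * t - 1) * C + 16 * y * (1 + y)\<^sup>2 * (b * n + d * v)" by algebra
  also have "\<dots> = 0" using E1 unfolding q .
  finally show 1: "(4 * t - 1) * C + 16 * (1 + y)\<^sup>2 * (b * n + d * v) = 0" using nz by simp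
  let ?Z = "(4 * t - 1) * (12 * n\<^sup>2 - 3 * v\<^sup>2) + 16 * (1 + y)\<^sup>2 * b"
  let ?E2 = "(8 * t\<^sup>2 * (1 + y) - 1) * C
      + y * (4 * t - 1) * (12 * n\<^sup>2 * n' - 3 * n' * v\<^sup>2 + 6 * n * v + 3 * v\<^sup>2)
      + 16 * ((1 + y) * (1 + 3 * y) * (b * n + d * v) + y * (1 + y)\<^sup>2 * (b * n' - d))"
  \<comment> \<open>Eliminate the derivative with respect to \<open>v\<close> by Euler's relation for forms homogeneous in \<open>n\<close> and \<open>v\<close>.
    The remaining multiple of \<open>C\<close> is the derivative of \<open>j\<close>, hence a multiple of \<open>t (1 + y)\<^sup>2 - y\<close>.\<close>
  have "y * (1 + y) * (v * n' + n) * ?Z = v * (1 + y) * ?E2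
    + C * (t * (1 + y)\<^sup>2 - y) * (4 - 8 * t * v)
    - ((4 * t - 1) * C + 16 * (1 + y)\<^sup>2 * (b * n + d * v)) * (v * (1 + 3 * y) - y * (1 + y))"
    unfolding C v by algebra
  moreover have "?E2 = 0" using E2 unfolding q .
  moreover have "t * (1 + y)\<^sup>2 - y = 0" using y by simp
  ultimately have "y * (1 + y) * (v * n' + n) * ?Z = 0"
    by (simp only: 1 mult_zero_left mult_zero_right add_0_right diff_0_right)
  then show "?Z = 0" using nz by simp
qed

text \<open>At the critical point \<open>j = -(1 - 4t)\<^sup>2\<close>, and the two equations express \<open>b\<close> and \<open>d\<close> through the double root
  \<open>m\<close>. The conclusion is the discriminant of \<open>J (4m\<^sup>3 - 3m - 1) + B m + D\<close> with respect to \<open>m\<close>, up to a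
  factor \<open>J\<close> and a constant.\<close>
lemma discriminant_vanishes:
  fixes y n v t b d m :: "'a::idom"
  assumes y: "y = t * (1 + y)\<^sup>2" and v: "v = 1 - y" and n: "n = v * m"
    and 1: "(4 * t - 1) * (4 * n ^ 3 - 3 * n * v\<^sup>2 - v ^ 3) + 16 * (1 + y)\<^sup>2 * (b * n + d * v) = 0"
    and 2: "(4 * t - 1) * (12 * n\<^sup>2 - 3 * v\<^sup>2) + 16 * (1 + y)\<^sup>2 * b = 0"
    and nz: "1 + y \<noteq> 0" "v \<noteq> 0"
    and B: "B = 16 * b" and D: "D = 16 * d" and J: "J = - (1 - 4 * t)\<^sup>2"
  shows "B ^ 3 + (27 * D\<^sup>2 - 9 * B\<^sup>2) * J + 27 * (B - 2 * D) * J\<^sup>2 = 0"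
proof -
  have v2: "v\<^sup>2 = (1 + y)\<^sup>2 * (1 - 4 * t)"
  proof -
    have "v\<^sup>2 = (1 + y)\<^sup>2 - 4 * y" unfolding v by algebra
    also have "\<dots> = (1 + y)\<^sup>2 - 4 * (t * (1 + y)\<^sup>2)" using y by simp
    finally show ?thesis by algebra
  qed
  let ?e = "(4 * t - 1) * (4 * n ^ 3 - 3 * n * v\<^sup>2 - v ^ 3) + 16 * (1 + y)\<^sup>2 * (b * n + d * v)"
  have "v * (1 + y)\<^sup>2 * (J * (4 * m ^ 3 - 3 * m - 1) + (B * m + D))
      = v * (((1 + y)\<^sup>2 * (1 - 4 * t)) * ((4 * t - 1) * (4 * m ^ 3 - 3 * m - 1)) + (1 + y)\<^sup>2 * (B * m + D))"
    unfolding J by algebra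
  also have "\<dots> = ?e" unfolding v2[symmetric] n B D by algebra
  finally have "J * (4 * m ^ 3 - 3 * m - 1) + (B * m + D) = 0" using nz 1 by simp
  then have d: "D = - B * m - J * (4 * m ^ 3 - 3 * m - 1)" by (simp add: eq_neg_iff_add_eq_0 algebra_simps)
  let ?f = "(4 * t - 1) * (12 * n\<^sup>2 - 3 * v\<^sup>2) + 16 * (1 + y)\<^sup>2 * b"
  have "(1 + y)\<^sup>2 * (J * (12 * m\<^sup>2 - 3) + B)
      = ((1 + y)\<^sup>2 * (1 - 4 * t)) * ((4 * t - 1) * (12 * m\<^sup>2 - 3)) + (1 + y)\<^sup>2 * B"
    unfolding J by algebra
  also have "\<dots> = ?f" unfolding v2[symmetric] n B by algebra
  finally have "J * (12 * m\<^sup>2 - 3) + B = 0" using nz 2 by simp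
  then have b: "B = - J * (12 * m\<^sup>2 - 3)" by (simp add: eq_neg_iff_add_eq_0 algebra_simps)
  show ?thesis unfolding d unfolding b by algebra
qed

lemma compose_X2_inject:
  fixes f g :: "'a::comm_ring_1 fps"
  assumes "f oo fps_X\<^sup>2 = g oo fps_X\<^sup>2"
  shows "f = g"
proof (rule fps_ext)
  fix n
  have "(h oo fps_X\<^sup>2) $ (2 * n) = h $ n" for h :: "'a fps"
  proof -
    have "(h oo fps_X\<^sup>2) $ (2 * n) = (\<Sum>i=0..2*n. if i = n then h $ n else 0)"
      unfolding fps_compose_nth by (intro sum.cong) (auto simp: fps_X_power_nth simp flip: power_mult)
    then show ?thesis by simp
  qed
  then show "f $ n = g $ n" using assms by metis
qed

lemma discriminant_equation:
  fixes B D :: "real fps"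
  defines "B \<equiv> 16 * (\<beta> oo fps_X\<^sup>2)" and "D \<equiv> 16 * (\<delta> oo fps_X\<^sup>2)" 
    and "J \<equiv> - (1 - 4 * fps_X)\<^sup>2"
  shows "B ^ 3 + (27 * D\<^sup>2 - 9 * B\<^sup>2) * J + 27 * (B - 2 * D) * J\<^sup>2 = 0"
proof -
  obtain y :: "real fps" where y: "y = fps_X * ((1 + fps_X)\<^sup>2 oo y)" "y $ 0 = 0"
    using ex_fps_fixpoint[of "(1 + fps_X :: real fps)\<^sup>2"] by (auto simp: power2_eq_square)
  have y1: "y = fps_X * (1 + y)\<^sup>2"
    using y by (simp add: fps_compose_power[symmetric] fps_compose_add_distrib)
  \<comment> \<open>The cubic form, with powers written as products so that the product rule applies.\<close>
  define R where "R = (4 * fps_X * ((1 + U) * (1 + U)) - U) *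
      (4 * (N_series * N_series * N_series) - 3 * N_series * ((1 - U) * (1 - U)) - (1 - U) * (1 - U) * (1 - U))
    + 16 * U * ((1 + U) * (1 + U)) * (fps_lift \<beta> * N_series + fps_lift \<delta> * (1 - U))"
  have R0: "R = 0" using cubic_form \<Theta>_eq_0 by (simp add: R_def power2_eq_square power3_eq_cube)
  define n where "n = ev2 y N_series"
  define n' where "n' = ev2 y (fps_pderiv N_series)"
  define b where "b = \<beta> oo fps_X\<^sup>2"
  define d where "d = \<delta> oo fps_X\<^sup>2"
  let ?t = "fps_X :: real fps"
  define C where "C = 4 * n ^ 3 - 3 * n * (1 - y)\<^sup>2 - (1 - y) ^ 3"
  have "ev2 y R = 0" using R0 by simp
  moreover have "ev2 y R = (4 * ?t\<^sup>2 * (1 + y)\<^sup>2 - y) * C + 16 * y * (1 + y)\<^sup>2 * (b * n + d * (1 - y))"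
    unfolding R_def ev2_simps fps_ev_add fps_ev_diff fps_ev_1 fps_ev_numeral ev_U C_def 
      n_def[symmetric] b_def[symmetric] d_def[symmetric] by algebra
  ultimately have E1: "(4 * ?t\<^sup>2 * (1 + y)\<^sup>2 - y) * C + 16 * y * (1 + y)\<^sup>2 * (b * n + d * (1 - y)) = 0"
    by (simp only:)
  have "fps_pderiv 0 = (0 :: real poly fps)" by (rule fps_ext) (simp add: fps_pderiv_def)
  then have "ev2 y (fps_pderiv R) = 0" using R0 by simp
  moreover have "ev2 y (fps_pderiv R) = (8 * ?t\<^sup>2 * (1 + y) - 1) * C
      + (4 * ?t\<^sup>2 * (1 + y)\<^sup>2 - y) * (12 * n\<^sup>2 * n' - 3 * n' * (1 - y)\<^sup>2 + 6 * n * (1 - y) + 3 * (1 - y)\<^sup>2)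
      + 16 * ((1 + y) * (1 + 3 * y) * (b * n + d * (1 - y)) + y * (1 + y)\<^sup>2 * (b * n' - d))"
    unfolding R_def fps_pderiv_mult fps_pderiv_add fps_pderiv_diff fps_pderiv_1 fps_pderiv_numeral
      fps_pderiv_U fps_pderiv_lift fps_pderiv_X
      ev2_simps fps_ev_add fps_ev_diff fps_ev_1 fps_ev_0 fps_ev_numeral ev_U C_def 
      n_def[symmetric] n'_def[symmetric] b_def[symmetric] d_def[symmetric] by algebra
  ultimately have E2: "(8 * ?t\<^sup>2 * (1 + y) - 1) * C
      + (4 * ?t\<^sup>2 * (1 + y)\<^sup>2 - y) * (12 * n\<^sup>2 * n' - 3 * n' * (1 - y)\<^sup>2 + 6 * n * (1 - y) + 3 * (1 - y)\<^sup>2)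
      + 16 * ((1 + y) * (1 + 3 * y) * (b * n + d * (1 - y)) + y * (1 + y)\<^sup>2 * (b * n' - d)) = 0"
    by (simp only:)
  have n0: "n $ 0 = 1" by (simp add: n_def ev2_N ev2_simps y(2) fps_numeral_split)
  have "N_series $ 0 = [:1, 2:]" by (simp add: N_series_def U_def numeral_poly fps_numeral_nth one_pCons)
  then have n0': "n' $ 0 = 2"
    using ev2_lowest(2)[of 0 "fps_pderiv N_series" y] by (simp add: n'_def fps_pderiv_def pderiv_pCons)
  have nz: "y \<noteq> 0" "1 + y \<noteq> 0" "(1 - y) * n' + n \<noteq> 0" "1 - y \<noteq> 0"
  proof -
    show "y \<noteq> 0" using y1 by auto
    have "(1 + y) $ 0 \<noteq> 0" "((1 - y) * n' + n) $ 0 \<noteq> 0" "(1 - y) $ 0 \<noteq> 0" 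
      using y(2) n0 n0' by simp_all
    then show "1 + y \<noteq> 0" "(1 - y) * n' + n \<noteq> 0" "1 - y \<noteq> 0" by (metis fps_zero_nth)+
  qed
  note dr = double_root[OF y1 refl C_def E1 E2 nz(1-3)]
  define m where "m = n * inverse (1 - y)"
  have "(1 - y) * inverse (1 - y) = 1" using y(2) by (simp add: inverse_mult_eq_1')
  then have n: "n = (1 - y) * m" unfolding m_def by (metis mult.left_commute mult_1_right)
  show ?thesis
    using discriminant_vanishes[OF y1 refl n dr(1)[unfolded C_def] dr(2) nz(2,4) refl refl refl]
    unfolding B_def D_def J_def b_def d_def .
qed

lemma quadratic_both_roots:
  fixes p q r J J' :: "'a::idom"
  assumes "p + q * J + r * J\<^sup>2 = 0" "p + q * J' + r * J'\<^sup>2 = 0" "J \<noteq> J'"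
  shows "q = - r * (J + J')" "p = r * J * J'"
proof -
  have "(J - J') * (q + r * (J + J')) = (p + q * J + r * J\<^sup>2) - (p + q * J' + r * J'\<^sup>2)" by algebra
  also have "\<dots> = 0" using assms(1,2) by simp
  finally have "(J - J') * (q + r * (J + J')) = 0" .
  then have "q + r * (J + J') = 0" using assms(3) by simp
  then show q: "q = - r * (J + J')" by (simp add: eq_neg_iff_add_eq_0)
  have "p - r * J * J' = p + q * J + r * J\<^sup>2" unfolding q by algebra
  then show "p = r * J * J'" using assms(1) by simp
qed

text \<open>The discriminant is quadratic in \<open>J\<close>. It vanishes at \<open>-(1 - 4t)\<^sup>2\<close>, and also at \<open>-(1 + 4t)\<^sup>2\<close> since its coefficients
  are series in \<open>t\<^sup>2\<close>. The two equations are those for the sum and the product of its roots.\<close>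
lemma algebraic_system:
  fixes B D :: "real fps"
  defines "B \<equiv> 16 * \<beta>" and "D \<equiv> 16 * \<delta>"
  shows "3 * D\<^sup>2 - B\<^sup>2 = 6 * (1 + 16 * fps_X) * (B - 2 * D)"
    and "B ^ 3 = 27 * (B - 2 * D) * (1 - 16 * fps_X)\<^sup>2"
proof -
  let ?B = "16 * (\<beta> oo fps_X\<^sup>2)" and ?D = "16 * (\<delta> oo fps_X\<^sup>2)"
  let ?t = "fps_X :: real fps"
  define J where "J = - (1 - 4 * ?t)\<^sup>2"
  define J' where "J' = - (1 + 4 * ?t)\<^sup>2"
  have E: "?B ^ 3 + (27 * ?D\<^sup>2 - 9 * ?B\<^sup>2) * J + 27 * (?B - 2 * ?D) * J\<^sup>2 = 0"
    unfolding J_def by (rule discriminant_equation)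
  have X0: "(- fps_X :: real fps) $ 0 = 0" by simp
  have sq: "(f oo fps_X\<^sup>2) oo (- fps_X) = f oo fps_X\<^sup>2" for f :: "real fps"
    by (subst fps_compose_assoc[symmetric]) (simp_all add: fps_compose_power[symmetric])
  have num: "(numeral k :: real fps) oo (- fps_X) = numeral k" for k
    by (simp add: numeral_fps_const)
  have "(?B ^ 3 + (27 * ?D\<^sup>2 - 9 * ?B\<^sup>2) * J + 27 * (?B - 2 * ?D) * J\<^sup>2) oo (- fps_X) = 0"
    unfolding E by simp
  moreover have "J oo (- fps_X) = J'"
    by (simp add: J_def J'_def fps_compose_uminus fps_compose_power[OF X0, symmetric] fps_compose_sub_distrib
      fps_compose_mult_distrib[OF X0] num)
  ultimately have E': "?B ^ 3 + (27 * ?D\<^sup>2 - 9 * ?B\<^sup>2) * J' + 27 * (?B - 2 * ?D) * J'\<^sup>2 = 0"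
    by (simp add: fps_compose_power[OF X0, symmetric] fps_compose_sub_distrib fps_compose_add_distrib
      fps_compose_mult_distrib[OF X0] num sq)
  have "J - J' = 16 * fps_X" unfolding J_def J'_def by algebra
  then have "J \<noteq> J'" by auto
  note qr = quadratic_both_roots[OF E E' this]
  have c: "numeral k = (numeral k oo fps_X\<^sup>2 :: real fps)" for k by (simp add: numeral_fps_const)
  have X: "fps_X\<^sup>2 = (fps_X oo fps_X\<^sup>2 :: real fps)" by simp
  have 1: "3 * ?D\<^sup>2 - ?B\<^sup>2 = 6 * (1 + 16 * fps_X\<^sup>2) * (?B - 2 * ?D)"
  proof -
    have "9 * (3 * ?D\<^sup>2 - ?B\<^sup>2 - 6 * (1 + 16 * fps_X\<^sup>2) * (?B - 2 * ?D))
      = (27 * ?D\<^sup>2 - 9 * ?B\<^sup>2) - (- (27 * (?B - 2 * ?D)) * (J + J'))"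
      unfolding J_def J'_def by algebra
    also have "\<dots> = 0" using qr(1) by simp
    finally have "3 * ?D\<^sup>2 - ?B\<^sup>2 - 6 * (1 + 16 * fps_X\<^sup>2) * (?B - 2 * ?D) = 0"
      by (simp only: mult_eq_0_iff) simp
    then show ?thesis by (simp only: right_minus_eq)
  qed
  have 2: "?B ^ 3 = 27 * (?B - 2 * ?D) * (1 - 16 * fps_X\<^sup>2)\<^sup>2"
    unfolding qr(2) unfolding J_def J'_def by algebra
  have "(3 * D\<^sup>2 - B\<^sup>2) oo fps_X\<^sup>2 = (6 * (1 + 16 * fps_X) * (B - 2 * D)) oo fps_X\<^sup>2"
    using 1 by (simp add: B_def D_def fps_compose_power[OF X2_nth_0, symmetric] fps_compose_sub_distrib fps_compose_add_distrib
      fps_compose_mult_distrib[OF X2_nth_0] flip: c)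
  then show "3 * D\<^sup>2 - B\<^sup>2 = 6 * (1 + 16 * fps_X) * (B - 2 * D)" by (rule compose_X2_inject)
  have "(B ^ 3) oo fps_X\<^sup>2 = (27 * (B - 2 * D) * (1 - 16 * fps_X)\<^sup>2) oo fps_X\<^sup>2"
    using 2 by (simp add: B_def D_def fps_compose_power[OF X2_nth_0, symmetric] fps_compose_sub_distrib fps_compose_add_distrib
      fps_compose_mult_distrib[OF X2_nth_0] flip: c)
  then show "B ^ 3 = 27 * (B - 2 * D) * (1 - 16 * fps_X)\<^sup>2" by (rule compose_X2_inject)
qed

section \<open>Rational parametrization\<close>

text \<open>Up to a factor \<open>2\<close> this is \<open>1/2 + \<eta>(-1)\<close>, the value that enters \<open>\<Theta>(-1)\<close> and carries the numbers to be found.\<close>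
definition \<zeta> :: "real fps" where "\<zeta> = 1 - 2 * fps_X * eval_at (- 1) axis_series"

lemma \<zeta>_nth_0: "\<zeta> $ 0 = 1"
  by (simp add: \<zeta>_def)

text \<open>The cube root that uniformizes the algebraic system: \<open>\<epsilon>\<^sup>3 = (1 - 16s) / \<zeta>\<^sup>2\<close>. Its definition as a quotient makes it a
  power series at once.\<close>
definition \<epsilon> :: "real fps" where "\<epsilon> = 9 * (1 - 16 * fps_X) * inverse (16 * \<beta>)"

lemma \<beta>_nth_0: "(16 * \<beta>) $ 0 = 9"
  by (simp add: \<beta>_def eval_at_nth B_series_def power2_eq_square)

lemma \<epsilon>_nth_0: "\<epsilon> $ 0 = 1"
  using \<beta>_nth_0 by (simp add: \<epsilon>_def)

text \<open>With \<open>B = 16\<beta>\<close> and \<open>D = 16\<delta>\<close>, the equation \<open>\<Theta>(-1) = 0\<close> reads \<open>B - 2D = 27\<zeta>\<^sup>2\<close>. The product of the roots of the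
  discriminant gives \<open>B\<^sup>3 = (27 \<zeta> (1 - 16s))\<^sup>2\<close>, so that \<open>B = 9\<zeta>\<^sup>2\<epsilon>\<^sup>2\<close>; their sum gives \<open>s\<close> as a
  rational function of \<open>\<epsilon>\<close>.\<close>
lemma parametrization:
  "\<zeta>\<^sup>2 * \<epsilon> ^ 3 = 1 - 16 * fps_X"
  "\<zeta>\<^sup>2 * ((1 + \<epsilon>) * (3 - \<epsilon>) ^ 3) = 16"
  "\<zeta>\<^sup>2 * ((1 - \<epsilon>) * (3 + \<epsilon>) ^ 3) = 256 * fps_X"
proof -
  define B where "B = 16 * \<beta>"
  define D where "D = 16 * \<delta>"
  let ?s = "1 - 16 * fps_X :: real fps"
  have nz: "B \<noteq> 0" "\<zeta> \<noteq> 0" using \<beta>_nth_0 \<zeta>_nth_0 by (auto simp: B_def)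
  have 1: "3 * D\<^sup>2 - B\<^sup>2 = 6 * (1 + 16 * fps_X) * (B - 2 * D)" and 2: "B ^ 3 = 27 * (B - 2 * D) * ?s\<^sup>2"
    using algebraic_system by (simp_all only: B_def D_def)
  have 3: "B - 2 * D = 27 * \<zeta>\<^sup>2"
  proof -
    have "eval_at (- 1) \<Theta> = 0" by (simp add: \<Theta>_eq_0 eval_at_def)
    then show ?thesis unfolding \<Theta>_minus_1 \<zeta>_def B_def D_def by (simp add: algebra_simps)
  qed
  have Be: "9 * ?s = B * \<epsilon>"
  proof -
    have "B * inverse B = 1" using \<beta>_nth_0 by (simp add: B_def inverse_mult_eq_1')
    moreover have "B * \<epsilon> = 9 * ?s * (B * inverse B)" unfolding \<epsilon>_def B_def by (simp only: ac_simps)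
    ultimately show ?thesis by simp
  qed
  have "B\<^sup>2 * B = B\<^sup>2 * (9 * \<zeta>\<^sup>2 * \<epsilon>\<^sup>2)"
  proof -
    have "B\<^sup>2 * B = 9 * \<zeta>\<^sup>2 * (9 * ?s)\<^sup>2" using 2 unfolding 3 by algebra
    then show ?thesis unfolding Be by algebra
  qed
  then have B: "B = 9 * \<zeta>\<^sup>2 * \<epsilon>\<^sup>2" using nz by simp
  have "9 * (\<zeta>\<^sup>2 * \<epsilon> ^ 3) = 9 * ?s" unfolding Be B by algebra
  then show P: "\<zeta>\<^sup>2 * \<epsilon> ^ 3 = ?s" by (subst (asm) mult_left_cancel) simp_all
  have "(81 * \<zeta>\<^sup>2) * (\<zeta>\<^sup>2 * (27 - 18 * \<epsilon>\<^sup>2 - \<epsilon> ^ 4)) = (81 * \<zeta>\<^sup>2) * (8 * (1 + 16 * fps_X))"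
  proof -
    have D: "2 * D = 9 * \<zeta>\<^sup>2 * (\<epsilon>\<^sup>2 - 3)" using 3 unfolding B by algebra
    have "(81 * \<zeta>\<^sup>2) * (\<zeta>\<^sup>2 * (27 - 18 * \<epsilon>\<^sup>2 - \<epsilon> ^ 4)) = 3 * (2 * D)\<^sup>2 - 4 * B\<^sup>2"
      unfolding D B by algebra
    also have "\<dots> = 4 * (3 * D\<^sup>2 - B\<^sup>2)" by algebra
    also have "\<dots> = 4 * (6 * (1 + 16 * fps_X) * (27 * \<zeta>\<^sup>2))" unfolding 1 3 ..
    finally show ?thesis by algebra
  qed
  then have Q: "\<zeta>\<^sup>2 * (27 - 18 * \<epsilon>\<^sup>2 - \<epsilon> ^ 4) = 8 * (1 + 16 * fps_X)" using nz by simp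
  have "\<zeta>\<^sup>2 * ((1 + \<epsilon>) * (3 - \<epsilon>) ^ 3) = \<zeta>\<^sup>2 * (27 - 18 * \<epsilon>\<^sup>2 - \<epsilon> ^ 4) + 8 * (\<zeta>\<^sup>2 * \<epsilon> ^ 3)" by algebra
  then show "\<zeta>\<^sup>2 * ((1 + \<epsilon>) * (3 - \<epsilon>) ^ 3) = 16" unfolding P Q by simp
  have "\<zeta>\<^sup>2 * ((1 - \<epsilon>) * (3 + \<epsilon>) ^ 3) = \<zeta>\<^sup>2 * (27 - 18 * \<epsilon>\<^sup>2 - \<epsilon> ^ 4) - 8 * (\<zeta>\<^sup>2 * \<epsilon> ^ 3)" by algebra
  then show "\<zeta>\<^sup>2 * ((1 - \<epsilon>) * (3 + \<epsilon>) ^ 3) = 256 * fps_X" unfolding P Q by simp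
qed

text \<open>The Euler operator, which multiplies coefficient \<open>n\<close> by \<open>n\<close>.\<close>
definition fps_theta :: "'a::comm_ring_1 fps \<Rightarrow> 'a fps" where
  "fps_theta f = fps_X * fps_deriv f"

lemma fps_theta_mult: "fps_theta (f * g) = fps_theta f * g + f * fps_theta g"
  by (simp add: fps_theta_def algebra_simps)

lemma fps_theta_add: "fps_theta (f + g) = fps_theta f + fps_theta g"
  by (simp add: fps_theta_def algebra_simps)

lemma fps_theta_diff: "fps_theta (f - g) = fps_theta f - fps_theta g"
  by (simp add: fps_theta_def algebra_simps)

lemma fps_theta_numeral: "fps_theta (numeral n) = 0" "fps_theta 1 = 0"
  by (simp_all add: fps_theta_def numeral_fps_const)

lemma fps_theta_nth: "fps_theta f $ n = of_nat n * f $ n"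
  by (cases n) (simp_all add: fps_theta_def)

lemma fps_theta_X: "fps_theta fps_X = fps_X"
  by (simp add: fps_theta_def)

text \<open>The Euler operator turns the first two equations of \<open>parametrization\<close> into a linear system for the two derivatives.\<close>
lemma theta_\<epsilon>_\<zeta>:
  "16 * \<epsilon>\<^sup>2 * fps_theta \<epsilon> = - (1 - \<epsilon>\<^sup>2) * (9 - \<epsilon>\<^sup>2)"
  "8 * \<epsilon> * fps_theta \<zeta> = - \<zeta> * (1 - \<epsilon>) * (3 + \<epsilon>)"
proof -
  define e1 where "e1 = fps_theta \<epsilon>"
  define z1 where "z1 = fps_theta \<zeta>"
  have nz: "\<zeta> \<noteq> 0" "\<epsilon> \<noteq> 0" "1 + \<epsilon> \<noteq> 0" "3 - \<epsilon> \<noteq> 0" "3 + \<epsilon> \<noteq> 0"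
  proof -
    have "(1 + \<epsilon>) $ 0 \<noteq> 0" "(3 - \<epsilon>) $ 0 \<noteq> 0" "(3 + \<epsilon>) $ 0 \<noteq> 0" "\<epsilon> $ 0 \<noteq> 0" "\<zeta> $ 0 \<noteq> 0"
      by (simp_all add: \<epsilon>_nth_0 \<zeta>_nth_0)
    then show "\<zeta> \<noteq> 0" "\<epsilon> \<noteq> 0" "1 + \<epsilon> \<noteq> 0" "3 - \<epsilon> \<noteq> 0" "3 + \<epsilon> \<noteq> 0" by (metis fps_zero_nth)+
  qed
  have "fps_theta (\<zeta> * \<zeta> * ((1 + \<epsilon>) * ((3 - \<epsilon>) * (3 - \<epsilon>) * (3 - \<epsilon>)))) = fps_theta 16"
    using parametrization(2) by (simp add: power2_eq_square power3_eq_cube)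
  then have "2 * \<zeta> * (3 - \<epsilon>)\<^sup>2 * (z1 * (1 + \<epsilon>) * (3 - \<epsilon>) - 2 * \<epsilon> * \<zeta> * e1) = 0"
    unfolding fps_theta_mult fps_theta_add fps_theta_diff fps_theta_numeral e1_def[symmetric] z1_def[symmetric]
    by algebra
  then have 1: "z1 * (1 + \<epsilon>) * (3 - \<epsilon>) = 2 * \<epsilon> * \<zeta> * e1" using nz by simp
  have "fps_theta (\<zeta> * \<zeta> * (\<epsilon> * \<epsilon> * \<epsilon>)) = fps_theta (1 - 16 * fps_X)"
    using parametrization(1) by (simp add: power2_eq_square power3_eq_cube)
  then have "2 * \<zeta> * z1 * \<epsilon> ^ 3 + 3 * \<zeta>\<^sup>2 * \<epsilon>\<^sup>2 * e1 = - (16 * fps_X)"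
    unfolding fps_theta_mult fps_theta_add fps_theta_diff fps_theta_numeral fps_theta_X e1_def[symmetric] z1_def[symmetric]
    by algebra
  then have "16 * (2 * \<zeta> * z1 * \<epsilon> ^ 3 + 3 * \<zeta>\<^sup>2 * \<epsilon>\<^sup>2 * e1) = - (\<zeta>\<^sup>2 * ((1 - \<epsilon>) * (3 + \<epsilon>) ^ 3))"
    unfolding parametrization(3) by simp
  then have "\<zeta> * (16 * (2 * z1 * \<epsilon> ^ 3 + 3 * \<zeta> * \<epsilon>\<^sup>2 * e1) + \<zeta> * (1 - \<epsilon>) * (3 + \<epsilon>) ^ 3) = 0"
    by algebra
  then have 2: "16 * (2 * z1 * \<epsilon> ^ 3 + 3 * \<zeta> * \<epsilon>\<^sup>2 * e1) + \<zeta> * (1 - \<epsilon>) * (3 + \<epsilon>) ^ 3 = 0" using nz by simp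
  have "\<zeta> * (3 + \<epsilon>)\<^sup>2 * (16 * \<epsilon>\<^sup>2 * e1 + (1 - \<epsilon>\<^sup>2) * (9 - \<epsilon>\<^sup>2)) =
    (1 + \<epsilon>) * (3 - \<epsilon>) * (16 * (2 * z1 * \<epsilon> ^ 3 + 3 * \<zeta> * \<epsilon>\<^sup>2 * e1) + \<zeta> * (1 - \<epsilon>) * (3 + \<epsilon>) ^ 3)
    - 32 * \<epsilon> ^ 3 * (z1 * (1 + \<epsilon>) * (3 - \<epsilon>) - 2 * \<epsilon> * \<zeta> * e1)" by algebra
  also have "\<dots> = 0" unfolding 1 2 by simp
  finally have "16 * \<epsilon>\<^sup>2 * e1 + (1 - \<epsilon>\<^sup>2) * (9 - \<epsilon>\<^sup>2) = 0" using nz by simp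
  then show 3: "16 * \<epsilon>\<^sup>2 * fps_theta \<epsilon> = - (1 - \<epsilon>\<^sup>2) * (9 - \<epsilon>\<^sup>2)"
    unfolding e1_def by (simp only: minus_mult_left[symmetric] eq_neg_iff_add_eq_0)
  have "(1 + \<epsilon>) * (3 - \<epsilon>) * (8 * \<epsilon> * z1 + \<zeta> * (1 - \<epsilon>) * (3 + \<epsilon>)) =
     8 * \<epsilon> * (z1 * (1 + \<epsilon>) * (3 - \<epsilon>) - 2 * \<epsilon> * \<zeta> * e1) 
     + \<zeta> * (16 * \<epsilon>\<^sup>2 * e1 - - (1 - \<epsilon>\<^sup>2) * (9 - \<epsilon>\<^sup>2))" by algebra
  also have "\<dots> = 0" unfolding 1 3[folded e1_def] by simp
  finally have "8 * \<epsilon> * z1 + \<zeta> * (1 - \<epsilon>) * (3 + \<epsilon>) = 0" using nz by simp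
  then show "8 * \<epsilon> * fps_theta \<zeta> = - \<zeta> * (1 - \<epsilon>) * (3 + \<epsilon>)"
    unfolding z1_def by (simp only: minus_mult_left[symmetric] eq_neg_iff_add_eq_0)
qed

section \<open>Hypergeometric coefficients\<close>

lemma \<epsilon>_nonzero: "\<epsilon> \<noteq> 0"
  using \<epsilon>_nth_0 by auto

text \<open>The factor \<open>3 - \<epsilon>\<^sup>2\<close> is determined by the local exponents of \<open>F(-1/2, -1/6; 2/3; 16s)\<close>: in the
  coordinate \<open>\<epsilon>\<close> the solution has no linear and no quadratic term at \<open>\<epsilon> = 0\<close>, which lies over \<open>16s = 1\<close>.\<close>
lemma theta_G2: "4 * fps_theta ((3 - \<epsilon>\<^sup>2) * \<zeta>) = \<zeta> * (1 - \<epsilon>) * (3 + \<epsilon>)"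
proof -
  have "(2 * \<epsilon>) * (4 * fps_theta ((3 - \<epsilon>\<^sup>2) * \<zeta>)) = 
      (8 * \<epsilon> * fps_theta \<zeta>) * (3 - \<epsilon>\<^sup>2) - \<zeta> * (16 * \<epsilon>\<^sup>2 * fps_theta \<epsilon>)"
    unfolding fps_theta_mult fps_theta_diff fps_theta_numeral power2_eq_square by algebra
  also have "\<dots> = (2 * \<epsilon>) * (\<zeta> * (1 - \<epsilon>) * (3 + \<epsilon>))" unfolding theta_\<epsilon>_\<zeta> by algebra
  finally show ?thesis using \<epsilon>_nonzero by (subst (asm) mult_left_cancel) auto
qed

lemma theta2_G2: "32 * \<epsilon>\<^sup>2 * fps_theta (fps_theta ((3 - \<epsilon>\<^sup>2) * \<zeta>)) = \<zeta> * (1 - \<epsilon>) * (3 + \<epsilon>) * (3 + 2 * \<epsilon> + 3 * \<epsilon>\<^sup>2)"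
proof -
  have t: "4 * fps_theta (fps_theta ((3 - \<epsilon>\<^sup>2) * \<zeta>)) = fps_theta (\<zeta> * (1 - \<epsilon>) * (3 + \<epsilon>))"
    unfolding theta_G2[symmetric] fps_theta_mult[of 4] fps_theta_numeral by simp
  have "32 * \<epsilon>\<^sup>2 * fps_theta (fps_theta ((3 - \<epsilon>\<^sup>2) * \<zeta>)) = 8 * \<epsilon>\<^sup>2 * (4 * fps_theta (fps_theta ((3 - \<epsilon>\<^sup>2) * \<zeta>)))"
    by algebra
  also have "\<dots> = 8 * \<epsilon>\<^sup>2 * fps_theta (\<zeta> * (1 - \<epsilon>) * (3 + \<epsilon>))" unfolding t ..
  also have "\<dots> = \<epsilon> * (8 * \<epsilon> * fps_theta \<zeta>) * (1 - \<epsilon>) * (3 + \<epsilon>) - \<zeta> * (1 + \<epsilon>) * (16 * \<epsilon>\<^sup>2 * fps_theta \<epsilon>)"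
    unfolding fps_theta_mult fps_theta_diff fps_theta_add fps_theta_numeral by algebra
  also have "\<dots> = \<zeta> * (1 - \<epsilon>) * (3 + \<epsilon>) * (3 + 2 * \<epsilon> + 3 * \<epsilon>\<^sup>2)" unfolding theta_\<epsilon>_\<zeta> by algebra
  finally show ?thesis .
qed

text \<open>The factor \<open>3 + \<epsilon>\<^sup>2\<close> comes from the local exponents of \<open>F(-1/2, 1/6; 1/3; 16s)\<close>: there is no linear term
  at \<open>\<epsilon> = 0\<close>, over \<open>16s = 1\<close>, and none at \<open>\<epsilon> = -3\<close>, over \<open>s = 0\<close>.\<close>
lemma theta_G1: "4 * \<epsilon> * fps_theta ((3 + \<epsilon>\<^sup>2) * \<zeta>) = - \<zeta> * (1 - \<epsilon>) * (3 + \<epsilon>)\<^sup>2"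
proof -
  have "2 * (4 * \<epsilon> * fps_theta ((3 + \<epsilon>\<^sup>2) * \<zeta>)) = 
      (8 * \<epsilon> * fps_theta \<zeta>) * (3 + \<epsilon>\<^sup>2) + \<zeta> * (16 * \<epsilon>\<^sup>2 * fps_theta \<epsilon>)"
    unfolding fps_theta_mult fps_theta_add fps_theta_numeral power2_eq_square by algebra
  also have "\<dots> = 2 * (- \<zeta> * (1 - \<epsilon>) * (3 + \<epsilon>)\<^sup>2)" unfolding theta_\<epsilon>_\<zeta> by algebra
  finally show ?thesis by (subst (asm) mult_left_cancel) simp_all
qed

lemma theta2_G1: "64 * \<epsilon> ^ 4 * fps_theta (fps_theta ((3 + \<epsilon>\<^sup>2) * \<zeta>)) =
   - \<zeta> * (1 - \<epsilon>) * (3 + \<epsilon>)\<^sup>2 * (9 + 3 * \<epsilon> - 5 * \<epsilon>\<^sup>2 + 9 * \<epsilon> ^ 3)"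
proof -
  let ?g = "fps_theta ((3 + \<epsilon>\<^sup>2) * \<zeta>)"
  have "fps_theta (4 * \<epsilon> * ?g) = fps_theta (- \<zeta> * (1 - \<epsilon>) * ((3 + \<epsilon>) * (3 + \<epsilon>)))"
    unfolding theta_G1 by (simp add: power2_eq_square)
  also have "- \<zeta> * (1 - \<epsilon>) * ((3 + \<epsilon>) * (3 + \<epsilon>)) = (0 - \<zeta>) * (1 - \<epsilon>) * ((3 + \<epsilon>) * (3 + \<epsilon>))" by simp
  finally have 1: "4 * fps_theta \<epsilon> * ?g + 4 * \<epsilon> * fps_theta ?g =
      - fps_theta \<zeta> * (1 - \<epsilon>) * (3 + \<epsilon>)\<^sup>2 + \<zeta> * fps_theta \<epsilon> * (3 + \<epsilon>) * (1 + 3 * \<epsilon>)"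
    unfolding fps_theta_mult[of _ ?g] fps_theta_mult[of _ \<epsilon>] fps_theta_mult[of _ "_ + \<epsilon>"] 
      fps_theta_mult[of _ "_ - \<epsilon>"] fps_theta_mult[of _ "_ * _"] fps_theta_diff fps_theta_add fps_theta_numeral 
    by (simp add: fps_theta_def algebra_simps power2_eq_square)
  have "64 * \<epsilon> ^ 4 * fps_theta ?g = 16 * \<epsilon> ^ 3 * (4 * fps_theta \<epsilon> * ?g + 4 * \<epsilon> * fps_theta ?g)
      - (16 * \<epsilon>\<^sup>2 * fps_theta \<epsilon>) * (4 * \<epsilon> * ?g)" by algebra
  also have "\<dots> = - 2 * \<epsilon>\<^sup>2 * (8 * \<epsilon> * fps_theta \<zeta>) * (1 - \<epsilon>) * (3 + \<epsilon>)\<^sup>2 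
      + \<epsilon> * \<zeta> * (16 * \<epsilon>\<^sup>2 * fps_theta \<epsilon>) * (3 + \<epsilon>) * (1 + 3 * \<epsilon>) - (16 * \<epsilon>\<^sup>2 * fps_theta \<epsilon>) * (4 * \<epsilon> * ?g)"
    unfolding 1 by algebra
  also have "\<dots> = - \<zeta> * (1 - \<epsilon>) * (3 + \<epsilon>)\<^sup>2 * (9 + 3 * \<epsilon> - 5 * \<epsilon>\<^sup>2 + 9 * \<epsilon> ^ 3)"
    unfolding theta_\<epsilon>_\<zeta> theta_G1 by algebra
  finally show ?thesis .
qed

lemma ode_G2:
  fixes G :: "real fps"
  defines "G \<equiv> (3 - \<epsilon>\<^sup>2) * \<zeta>"
  shows "12 * (1 - 16 * fps_X) * fps_theta (fps_theta G) - 4 * fps_theta G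
    + 128 * fps_X * fps_theta G - 16 * fps_X * G = 0"
proof -
  let ?P = "(1 + \<epsilon>) * (3 - \<epsilon>) ^ 3" and ?Q = "(1 - \<epsilon>) * (3 + \<epsilon>) ^ 3"
  have "16 * (12 * (1 - 16 * fps_X) * fps_theta (fps_theta G) - 4 * fps_theta G
    + 128 * fps_X * fps_theta G - 16 * fps_X * G)
    = 192 * (1 - 16 * fps_X) * fps_theta (fps_theta G) - 4 * 16 * fps_theta G
      + 8 * (256 * fps_X) * fps_theta G - (256 * fps_X) * G" by algebra
  also have "\<dots> = 192 * (\<zeta>\<^sup>2 * \<epsilon> ^ 3) * fps_theta (fps_theta G) - 4 * (\<zeta>\<^sup>2 * ?P) * fps_theta G
      + 8 * (\<zeta>\<^sup>2 * ?Q) * fps_theta G - (\<zeta>\<^sup>2 * ?Q) * G"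
    unfolding parametrization ..
  also have "\<dots> = \<zeta>\<^sup>2 * (6 * \<epsilon> * (32 * \<epsilon>\<^sup>2 * fps_theta (fps_theta G))
     + (2 * ?Q - ?P) * (4 * fps_theta G) - ?Q * G)"
    by algebra
  also have "\<dots> = 0" unfolding G_def theta_G2 theta2_G2 by algebra
  finally show ?thesis by (simp only: mult_eq_0_iff) simp
qed

lemma ode_G1:
  fixes G :: "real fps"
  defines "G \<equiv> (3 + \<epsilon>\<^sup>2) * \<zeta>"
  shows "12 * (1 - 16 * fps_X) * fps_theta (fps_theta G) - 8 * fps_theta G
    + 64 * fps_X * fps_theta G + 16 * fps_X * G = 0" (is "?L = 0")
proof -
  let ?P = "(1 + \<epsilon>) * (3 - \<epsilon>) ^ 3" and ?Q = "(1 - \<epsilon>) * (3 + \<epsilon>) ^ 3"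
  have "(16 * \<epsilon>) * ?L
    = 192 * \<epsilon> * (1 - 16 * fps_X) * fps_theta (fps_theta G) - 8 * \<epsilon> * 16 * fps_theta G
      + 4 * \<epsilon> * (256 * fps_X) * fps_theta G + \<epsilon> * (256 * fps_X) * G" by algebra
  also have "\<dots> = 192 * \<epsilon> * (\<zeta>\<^sup>2 * \<epsilon> ^ 3) * fps_theta (fps_theta G) - 8 * \<epsilon> * (\<zeta>\<^sup>2 * ?P) * fps_theta G
      + 4 * \<epsilon> * (\<zeta>\<^sup>2 * ?Q) * fps_theta G + \<epsilon> * (\<zeta>\<^sup>2 * ?Q) * G"
    unfolding parametrization ..
  also have "\<dots> = \<zeta>\<^sup>2 * (3 * (64 * \<epsilon> ^ 4 * fps_theta (fps_theta G))
     + (?Q - 2 * ?P) * (4 * \<epsilon> * fps_theta G) + \<epsilon> * ?Q * G)"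
    by algebra
  also have "\<dots> = 0" unfolding G_def theta_G1 theta2_G1 by algebra
  finally show ?thesis using \<epsilon>_nonzero by (simp only: mult_eq_0_iff) simp
qed

lemma hypergeometric_coefficients:
  fixes f :: "nat \<Rightarrow> real"
  assumes rec: "\<And>n. (real n + 1) * (real n + r) * f (Suc n) = x * ((real n + a) * (real n + b)) * f n"
    and r: "r > 0"
  shows "f n = f 0 * x ^ n * (pochhammer a n * pochhammer b n / (pochhammer r n * fact n))"
proof (induction n)
  case (Suc n)
  have nz: "real n + 1 > 0" "real n + r > 0" using r by auto
  have "f (Suc n) = x * ((real n + a) * (real n + b)) * f n / ((real n + 1) * (real n + r))"
    using nonzero_mult_div_cancel_left[of "(real n + 1) * (real n + r)" "f (Suc n)"] nz
    unfolding rec[of n] by simp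
  also have "\<dots> = f 0 * x ^ Suc n * (pochhammer a (Suc n) * pochhammer b (Suc n) / (pochhammer r (Suc n) * fact (Suc n)))"
    unfolding Suc pochhammer_Suc by (simp add: ac_simps)
  finally show ?case .
qed simp

lemma G2_nth: "((3 - \<epsilon>\<^sup>2) * \<zeta>) $ n =
  2 * 16 ^ n * (pochhammer (- 1/2) n * pochhammer (- 1/6) n / (pochhammer (2/3) n * fact n))"
proof -
  define G where "G = (3 - \<epsilon>\<^sup>2) * \<zeta>"
  have "12 * fps_theta (fps_theta G) - 192 * (fps_X * fps_theta (fps_theta G)) - 4 * fps_theta G
    + 128 * (fps_X * fps_theta G) - 16 * (fps_X * G) = 0" (is "?L = 0")
    using ode_G2 unfolding G_def[symmetric] by (simp add: algebra_simps)
  then have L: "?L $ Suc n = 0" for n by simp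
  have "(real n + 1) * (real n + 2/3) * G $ Suc n = 16 * ((real n + - 1/2) * (real n + - 1/6)) * G $ n" for n
  proof -
    have "12 * ((real n + 1) * ((real n + 1) * G $ Suc n)) - 192 * (real n * (real n * G $ n))
      - 4 * ((real n + 1) * G $ Suc n) + 128 * (real n * G $ n) - 16 * G $ n = 0"
      using L[of n] by (simp add: fps_theta_nth add.commute)
    then show ?thesis by (simp add: field_simps)
  qed
  from hypergeometric_coefficients[OF this, of n] have "G $ n = G $ 0 * 16 ^ n *
    (pochhammer (- 1/2) n * pochhammer (- 1/6) n / (pochhammer (2/3) n * fact n))" by simp
  moreover have "G $ 0 = 2" by (simp add: G_def \<epsilon>_nth_0 \<zeta>_nth_0 power2_eq_square)
  ultimately show ?thesis by (simp add: G_def)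
qed

lemma G1_nth: "((3 + \<epsilon>\<^sup>2) * \<zeta>) $ n =
  4 * 16 ^ n * (pochhammer (- 1/2) n * pochhammer (1/6) n / (pochhammer (1/3) n * fact n))"
proof -
  define G where "G = (3 + \<epsilon>\<^sup>2) * \<zeta>"
  have "12 * fps_theta (fps_theta G) - 192 * (fps_X * fps_theta (fps_theta G)) - 8 * fps_theta G
    + 64 * (fps_X * fps_theta G) + 16 * (fps_X * G) = 0" (is "?L = 0")
    using ode_G1 unfolding G_def[symmetric] by (simp add: algebra_simps)
  then have L: "?L $ Suc n = 0" for n by simp
  have "(real n + 1) * (real n + 1/3) * G $ Suc n = 16 * ((real n + - 1/2) * (real n + 1/6)) * G $ n" for n
  proof -
    have "12 * ((real n + 1) * ((real n + 1) * G $ Suc n)) - 192 * (real n * (real n * G $ n))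
      - 8 * ((real n + 1) * G $ Suc n) + 64 * (real n * G $ n) + 16 * G $ n = 0"
      using L[of n] by (simp add: fps_theta_nth add.commute)
    then show ?thesis by (simp add: field_simps)
  qed
  from hypergeometric_coefficients[OF this, of n] have "G $ n = G $ 0 * 16 ^ n *
    (pochhammer (- 1/2) n * pochhammer (1/6) n / (pochhammer (1/3) n * fact n))" by simp
  moreover have "G $ 0 = 4" by (simp add: G_def \<epsilon>_nth_0 \<zeta>_nth_0 power2_eq_square)
  ultimately show ?thesis by (simp add: G_def)
qed

text \<open>Since \<open>\<zeta> = 1 - 2s A(-1)\<close>, coefficient \<open>n\<close> of \<open>A(-1)\<close> comes from coefficient \<open>n + 1\<close> of the hypergeometric
  series; the shift raises all parameters by one.\<close>
lemma axis_series_at_minus_1_closed: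
  "2/3 * poly (axis_series $ n) (- 1) = 16 ^ n / 9 *
    (8 * (pochhammer (1/2) n * pochhammer (7/6) n / (pochhammer 2 n * pochhammer (4/3) n))
     - 2 * (pochhammer (1/2) n * pochhammer (5/6) n / (pochhammer 2 n * pochhammer (5/3) n)))"
proof -
  define p where "p = poly (axis_series $ n) (- 1)"
  have "6 * \<zeta> = ((3 + \<epsilon>\<^sup>2) * \<zeta>) + ((3 - \<epsilon>\<^sup>2) * \<zeta>)" by algebra
  then have "6 * \<zeta> $ Suc n = ((3 + \<epsilon>\<^sup>2) * \<zeta>) $ Suc n + ((3 - \<epsilon>\<^sup>2) * \<zeta>) $ Suc n"
    by (metis fps_add_nth fps_mult_numeral_left)
  moreover have "\<zeta> $ Suc n = - 2 * p"
    by (simp add: \<zeta>_def mult.assoc eval_at_nth p_def)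
  moreover have "pochhammer (- 1/2) (Suc n) = - 1/2 * pochhammer (1/2::real) n"
    "pochhammer (- 1/6) (Suc n) = - 1/6 * pochhammer (5/6::real) n"
    "pochhammer (1/6) (Suc n) = 1/6 * pochhammer (7/6::real) n"
    "pochhammer (1/3) (Suc n) = 1/3 * pochhammer (4/3::real) n"
    "pochhammer (2/3) (Suc n) = 2/3 * pochhammer (5/3::real) n"
    by (simp_all add: pochhammer_rec)
  moreover have "fact (Suc n) = pochhammer (2::real) n"
    by (simp add: pochhammer_fact pochhammer_rec)
  ultimately have "6 * (- 2 * p) = 
      4 * 16 ^ Suc n * (- 1/2 * pochhammer (1/2) n * (1/6 * pochhammer (7/6) n) / (1/3 * pochhammer (4/3) n * pochhammer 2 n))
    + 2 * 16 ^ Suc n * (- 1/2 * pochhammer (1/2) n * (- 1/6 * pochhammer (5/6) n) / (2/3 * pochhammer (5/3) n * pochhammer 2 n))"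
    by (simp only: G1_nth G2_nth)
  moreover have "pochhammer (4/3) n > (0::real)" "pochhammer (5/3) n > (0::real)" "pochhammer 2 n > (0::real)"
    by (simp_all add: pochhammer_pos)
  ultimately show ?thesis unfolding p_def[symmetric] by (simp add: field_simps)
qed

lemma c_closed_form:
  "real (c 0 0 (2 * n)) =
      16 ^ n / 9 *
        (3 * ((pochhammer (1/2) n)\<^sup>2 / (pochhammer 2 n)\<^sup>2)
         + 8 * (pochhammer (1/2) n * pochhammer (7/6) n / (pochhammer 2 n * pochhammer (4/3) n))
         - 2 * (pochhammer (1/2) n * pochhammer (5/6) n / (pochhammer 2 n * pochhammer (5/3) n)))"
proof -
  have "(4 ^ n * pochhammer (1/2) n / pochhammer 2 n)\<^sup>2 / 3 
      = 16 ^ n / 9 * (3 * ((pochhammer (1/2) n)\<^sup>2 / (pochhammer 2 n)\<^sup>2 :: real))"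
    by (simp add: power_divide power_mult_distrib power_mult[symmetric] mult.commute[of n])
       (simp add: power_mult)
  then show ?thesis
    unfolding c_eq_axis_series axis_series_at_minus_1_closed ballot_catalan by (simp add: algebra_simps)
qed

section \<open>Asymptotics\<close>

text \<open>Quotient of Gauss's limit formulas for \<open>Gamma b\<close> and \<open>Gamma a\<close>.\<close>
lemma pochhammer_ratio_tendsto:
  fixes a b :: real
  assumes "a > 0" "b > 0"
  shows "(\<lambda>n. pochhammer a n / pochhammer b n * real n powr (b - a)) \<longlonglongrightarrow> Gamma b / Gamma a"
proof -
  have nz: "Gamma a \<noteq> 0" using Gamma_real_pos[OF assms(1)] by linarith
  have lim: "(\<lambda>n. Gamma_series' b n / Gamma_series' a n) \<longlonglongrightarrow> Gamma b / Gamma a"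
    using nz by (intro tendsto_divide Gamma_series'_LIMSEQ)
  show ?thesis
  proof (rule Lim_transform_eventually[OF lim])
    show "eventually (\<lambda>n. Gamma_series' b n / Gamma_series' a n =
      pochhammer a n / pochhammer b n * real n powr (b - a)) sequentially"
      using eventually_gt_at_top[of 0]
    proof eventually_elim
      case (elim n)
      have "pochhammer a n > 0" "pochhammer b n > 0" using assms by (simp_all add: pochhammer_pos)
      moreover have "exp (b * ln (real n)) / exp (a * ln (real n)) = real n powr (b - a)"
        using elim by (simp add: powr_def left_diff_distrib exp_diff)
      ultimately show ?case unfolding Gamma_series'_def
        by (simp add: divide_simps mult_ac)
    qed
  qed
qed

lemma powr_neg_tendsto_0:
  assumes "p < 0"
  shows "(\<lambda>n. real n powr p) \<longlonglongrightarrow> 0"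
  using assms by (intro tendsto_neg_powr filterlim_real_sequentially)

lemma Gamma_constant:
  "Gamma 2 / Gamma (1/2) * (Gamma (4/3) / Gamma (7/6)) = 2 powr (1/3) * Gamma (2/3) / (pi :: real)"
proof -
  have "Gamma (2/3) * Gamma (2/3 + 1/2) = exp ((1 - 2 * (2/3)) * ln 2) * sqrt pi * Gamma (2 * (2/3) :: real)"
  proof -
    have "complex_of_real (2/3) \<notin> \<int>\<^sub>\<le>\<^sub>0" "complex_of_real (2/3) + 1/2 \<notin> \<int>\<^sub>\<le>\<^sub>0"
      by (auto elim!: nonpos_Ints_cases simp: complex_eq_iff)
    from Gamma_legendre_duplication[OF this]
    have "complex_of_real (Gamma (2/3) * Gamma (2/3 + 1/2)) = 
        of_real (exp ((1 - 2 * (2/3)) * ln 2) * sqrt pi * Gamma (2 * (2/3)))"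
      by (simp add: Gamma_complex_of_real[symmetric] exp_of_real[symmetric])
    then show ?thesis by (simp only: of_real_eq_iff)
  qed
  then have 1: "Gamma (2/3) * Gamma (7/6) = 2 powr (- 1/3) * sqrt pi * Gamma (4/3 :: real)"
    by (simp add: powr_def)
  have 2: "2 powr (1/3) * 2 powr (- 1/3) = (1::real)" by (simp flip: powr_add)
  have 3: "(2 powr (1/3) * Gamma (2/3)) * Gamma (7/6) = sqrt pi * Gamma (4/3 :: real)"
    unfolding mult.assoc 1 using 2 by (metis mult.assoc mult_1_left)
  have "Gamma 2 = (1::real)" using Gamma_fact[of 1, where ?'a = real] by simp
  moreover have "1 / s * (k / h) = q / (s * s)" if "q * h = s * k" "s > 0" "h > 0" for q s k h :: real
  proof -
    have k: "k = q * h / s" using that by (simp add: eq_divide_eq mult.commute)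
    show ?thesis unfolding k using that(2,3) by simp
  qed
  from this[OF 3] have "1 / sqrt pi * (Gamma (4/3) / Gamma (7/6)) = 2 powr (1/3) * Gamma (2/3) / (pi :: real)"
    by simp
  ultimately show ?thesis by (simp add: Gamma_one_half_real)
qed

text \<open>After division by \<open>16^n n^(-5/3)\<close> the three summands of the closed form behave like \<open>n^(-4/3)\<close>, a constant and
  \<open>n^(-2/3)\<close>.\<close>
lemma c_asymptotics:
  "(\<lambda>n::nat. real (c 0 0 (2 * n))) \<sim>[at_top]
     (\<lambda>n. 2 ^ 5 / 3 ^ 2 * (Gamma (2/3) / pi) * (4 ^ (2 * n) / (2 * real n) powr (5/3)))"
proof -
  define A where "A n = pochhammer (1/2) n / pochhammer 2 n * real n powr (2 - 1/2)" for n
  define B where "B n = pochhammer (7/6) n / pochhammer (4/3) n * real n powr (4/3 - 7/6)" for n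
  define C where "C n = pochhammer (5/6) n / pochhammer (5/3) n * real n powr (5/3 - 5/6)" for n
  define g where "g n = 16 ^ n / real n powr (5/3)" for n
  define K where "K = 2 powr (1/3) * Gamma (2/3) / (pi :: real)"
  have lims: "A \<longlonglongrightarrow> Gamma 2 / Gamma (1/2)" "B \<longlonglongrightarrow> Gamma (4/3) / Gamma (7/6)"
    "C \<longlonglongrightarrow> Gamma (5/3) / Gamma (5/6)"
    unfolding A_def B_def C_def by (rule pochhammer_ratio_tendsto; simp)+
  have lim: "(\<lambda>n. 1/9 * (3 * ((A n)\<^sup>2 * real n powr (- 4/3)) + 8 * (A n * B n) 
      - 2 * (A n * C n * real n powr (- 2/3)))) \<longlonglongrightarrow> 1/9 * (3 * ((Gamma 2 / Gamma (1/2))\<^sup>2 * 0) 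
      + 8 * (Gamma 2 / Gamma (1/2) * (Gamma (4/3) / Gamma (7/6))) 
      - 2 * (Gamma 2 / Gamma (1/2) * (Gamma (5/3) / Gamma (5/6)) * 0))"
    by (intro tendsto_intros lims powr_neg_tendsto_0) simp_all
  have "(\<lambda>n. real (c 0 0 (2 * n)) / g n) \<longlonglongrightarrow> 8/9 * K"
  proof (rule Lim_transform_eventually)
    show "(\<lambda>n. 1/9 * (3 * ((A n)\<^sup>2 * real n powr (- 4/3)) + 8 * (A n * B n) 
      - 2 * (A n * C n * real n powr (- 2/3)))) \<longlonglongrightarrow> 8/9 * K"
      using lim unfolding Gamma_constant K_def by simp
    show "eventually (\<lambda>n. 1/9 * (3 * ((A n)\<^sup>2 * real n powr (- 4/3)) + 8 * (A n * B n) 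
      - 2 * (A n * C n * real n powr (- 2/3))) = real (c 0 0 (2 * n)) / g n) sequentially"
      using eventually_gt_at_top[of 0]
    proof eventually_elim
      case (elim n)
      define x where "x = real n"
      have x: "x > 0" using elim by (simp add: x_def)
      have p: "x powr a * x powr b = x powr (a + b)" for a b using x by (simp add: powr_add)
      define a where "a = (pochhammer (1/2) n / pochhammer 2 n :: real)"
      define b where "b = (pochhammer (7/6) n / pochhammer (4/3) n :: real)"
      define d where "d = (pochhammer (5/6) n / pochhammer (5/3) n :: real)"
      have "(A n)\<^sup>2 * x powr (- 4/3) = a\<^sup>2 * ((x powr (3/2) * x powr (3/2)) * x powr (- 4/3))"
        by (simp add: A_def a_def x_def power2_eq_square)
      then have 1: "(A n)\<^sup>2 * x powr (- 4/3) = a\<^sup>2 * x powr (5/3)" unfolding p by simp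
      have "A n * B n = a * b * (x powr (3/2) * x powr (1/6))"
        by (simp add: A_def B_def a_def b_def x_def)
      then have 2: "A n * B n = a * b * x powr (5/3)" unfolding p by simp
      have "A n * C n * x powr (- 2/3) = a * d * ((x powr (3/2) * x powr (5/6)) * x powr (- 2/3))"
        by (simp add: A_def C_def a_def d_def x_def)
      then have 3: "A n * C n * x powr (- 2/3) = a * d * x powr (5/3)" unfolding p by simp
      have c: "real (c 0 0 (2 * n)) = 16 ^ n / 9 * (3 * a\<^sup>2 + 8 * (a * b) - 2 * (a * d))"
        unfolding c_closed_form a_def b_def d_def by (simp add: power_divide)
      have "real (c 0 0 (2 * n)) / g n = 1 / 9 * (3 * (a\<^sup>2 * x powr (5/3))
          + 8 * (a * b * x powr (5/3)) - 2 * (a * d * x powr (5/3)))"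
        unfolding c g_def x_def[symmetric] by (simp add: algebra_simps add_divide_distrib diff_divide_distrib)
      then show ?case unfolding x_def[symmetric] 1 2 3 ..
    qed
  qed
  moreover have "8/9 * K \<noteq> 0"
  proof -
    have "Gamma (2/3) > (0 :: real)" by (rule Gamma_real_pos) simp
    then have "Gamma (2/3) \<noteq> (0 :: real)" by (metis less_irrefl)
    then show ?thesis by (simp add: K_def)
  qed
  ultimately have "(\<lambda>n. real (c 0 0 (2 * n))) \<sim>[at_top] (\<lambda>n. 8/9 * K * g n)"
    by (rule asymp_equivI'_const)
  moreover have "8/9 * K * g n = 2 ^ 5 / 3 ^ 2 * (Gamma (2/3) / pi) * (4 ^ (2 * n) / (2 * real n) powr (5/3))" for n
  proof -
    have "2 powr (1/3) * 2 powr (5/3) = (2::real) powr 2" by (simp flip: powr_add)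
    then have "2 powr (1/3) = 4 / (2::real) powr (5/3)" by (simp add: eq_divide_eq)
    then show ?thesis by (simp add: K_def g_def powr_mult power_mult)
  qed
  ultimately show ?thesis by (simp only:)
qed

theorem mainTheorem9:
  shows "(\<forall>n::nat. real (c 0 0 (2 * n)) =
      16 ^ n / 9 *
        (3 * ((pochhammer (1/2) n)\<^sup>2 / (pochhammer 2 n)\<^sup>2)
         + 8 * (pochhammer (1/2) n * pochhammer (7/6) n / (pochhammer 2 n * pochhammer (4/3) n))
         - 2 * (pochhammer (1/2) n * pochhammer (5/6) n / (pochhammer 2 n * pochhammer (5/3) n))))
    \<and> (\<lambda>n::nat. real (c 0 0 (2 * n))) \<sim>[at_top]
        (\<lambda>n. 2 ^ 5 / 3 ^ 2 * (Gamma (2/3) / pi) * (4 ^ (2 * n) / (2 * real n) powr (5/3)))"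
  using c_closed_form c_asymptotics by blast

end
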